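(* Let $\mathbb{K}=\mathbb{R}$ or $\mathbb{C}$, let $A\in gl(n,\mathbb{K})$ and let $\widetilde{A}=A+E$ be a ${}^*\mathbb{K}$-perturbation of $A$, where $E=(\varepsilon_{i,j})\in gl(n,\mathcal{I})$. Then the characteristic polynomial $C_{\widetilde{A}}(X)$ of $\widetilde{A}$, which is a ${}^*\mathbb{K}$-perturbation of $C_A(X)$, is $$C_{\widetilde{A}}(X)=X^n-Q^{(1)}(A+E)X^{n-1}+\cdots+(-1)^jQ^{(j)}(A+E)X^{n-j}+\cdots+(-1)^nQ^{(n)}(A+E),$$ where, for $1\le k\le n$, $$Q^{(k)}(A+E)=Q^{(k)}(A)+\sum_{i=1}^{k}\frac{1}{i!(k-i)!}\,\Theta_{Q^{(k)}}(\underbrace{A,\ldots,A}_{k-i},\underbrace{E,\ldots,E}_{i}).$$ Moreover, if $$E=(\varepsilon_{i,j})=\alpha_1U_1+\alpha_1\alpha_2U_2+\cdots+\alpha_1\alpha_2\cdots\alpha_lU_l$$ is a decomposition of $E$ with $\alpha_1,\ldots,\alpha_l\in\mathcal{I}$ and $U_1,\ldots,U_l\in gl(n,\mathbb{K})$ linearly independent, then the approximation at order $1$ of $C_{\widetilde{A}}(X)-C_A(X)$ is given by the polynomial $$\Xi_1(X)=\alpha_1\sum_{k=1}^{n}(-1)^k\frac{1}{(k-1)!}\,\Theta_{Q^{(k)}}(A,\ldots,A,U_1)\,X^{n-k},$$ that is, $C_{\widetilde{A}}(X)-C_A(X)-\Xi_1(X)=\alpha_1R(X)$ for some polynomial $R(X)$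 all of whose coefficients belong to $\mathcal{I}$.
   Context: ${}^*\mathbb{K}$ is Robinson's nonstandard extension of $\mathbb{K}$ (hyperreals for $\mathbb{K}=\mathbb{R}$, and ${}^*\mathbb{C}={}^*\mathbb{R}+i\,{}^*\mathbb{R}$ for $\mathbb{K}=\mathbb{C}$), and $\mathcal{I}\subset{}^*\mathbb{K}$ is the set of infinitesimals (elements $z$ with $|z|<r$ for every real $r>0$). $gl(n,\cdot)$ denotes square matrices of order $n$ with entries in the indicated set. A ${}^*\mathbb{K}$-perturbation of $A\in gl(n,\mathbb{K})$ is a matrix $\widetilde{A}\in gl(n,{}^*\mathbb{K})$ such that all entries of $\widetilde{A}-A$ are in $\mathcal{I}$; a ${}^*\mathbb{K}$-perturbation of a polynomial in $\mathbb{K}[X]$ is a polynomial in ${}^*\mathbb{K}[X]$ of the same degree whose coefficients differ from the given ones by elements of $\mathcal{I}$. $C_A(X)=\det(X\,Id_n-A)$ is the characteristic polynomial. $Q^{(k)}(A)$ is the sum, over all $1\le i_1<\cdots<i_k\le n$, of the principal minors of $A$ with rows and columns $i_1,\ldots,i_k$ (so $Q^{(1)}=\mathrm{tr}$, $Q^{(n)}=\det$); it is a homogeneous polynomial of degree $k$ in the entries of $A$. $\Theta_{Q^{(k)}}$ is the symmetric $k$-linear form on matrices of order $n$ (extended to matrices over ${}^*\mathbb{K}$ by multilinearity) satisfying $\Theta_{Q^{(k)}}(A,\ldots,A)=k!\,Q^{(k)}(A)$ for all $A$. *)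

theory Defs
  imports
    Complex_Main
    "Jordan_Normal_Form.Char_Poly"
    "Jordan_Normal_Form.DL_Submatrix"
begin

section \<open>The nonstandard extension as an ultrapower\<close>

text \<open>A nonprincipal ultrafilter on the natural numbers: a proper filter that decides every
  predicate and contains all cofinite sets.\<close>

definition nonprincipal_ultrafilter :: "nat filter \<Rightarrow> bool" where
  "nonprincipal_ultrafilter F \<longleftrightarrow>
     F \<noteq> bot \<and> F \<le> cofinite \<and> (\<forall>P. eventually P F \<or> eventually (\<lambda>m. \<not> P m) F)"

lemma nonprincipal_ultrafilter_exists: "\<exists>F. nonprincipal_ultrafilter F"
proof -
  let ?r = "{(F, G :: nat filter). F \<ge> G \<and> G \<noteq> bot \<and> F \<noteq> bot \<and> F \<le> cofinite \<and> G \<le> cofinite}"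
  have field_r: "Field ?r = {F. F \<noteq> bot \<and> F \<le> cofinite}"
    by (auto simp: Field_def)
  have po: "Partial_order ?r"
    unfolding partial_order_on_def preorder_on_def field_r
    by (auto simp: refl_on_def antisym_def trans_def)
  have "\<exists>M\<in>Field ?r. \<forall>F\<in>Field ?r. (M, F) \<in> ?r \<longrightarrow> F = M"
  proof (rule Zorns_po_lemma[OF po])
    fix C assume C: "C \<in> Chains ?r"
    show "\<exists>u\<in>Field ?r. \<forall>F\<in>C. (F, u) \<in> ?r"
    proof (cases "C = {}")
      case True
      have "(cofinite :: nat filter) \<noteq> bot" by simp
      then show ?thesis using True unfolding field_r by (metis (mono_tags) empty_iff mem_Collect_eq order_refl)
    next
      case False
      have mem: "F \<noteq> bot" "F \<le> cofinite" if "F \<in> C" for F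
        using C that by (auto simp: Chains_def)
      have tot: "F \<le> G \<or> G \<le> F" if "F \<in> C" "G \<in> C" for F G
        using C that by (auto simp: Chains_def)
      have "Inf C \<noteq> bot"
      proof
        assume "Inf C = bot"
        then have "eventually (\<lambda>_. False) (Inf C)" by simp
        also have "?this \<longleftrightarrow> (\<exists>F\<in>C. eventually (\<lambda>_. False) F)"
        proof (rule eventually_Inf_base[OF False])
          fix F G assume "F \<in> C" "G \<in> C"
          with tot[OF this] show "\<exists>x\<in>C. x \<le> inf F G" by (metis inf.orderE inf_commute order_refl)
        qed
        finally show False using mem(1) by (auto simp: trivial_limit_def)
      qed
      moreover have "Inf C \<le> cofinite"
        using False mem(2) by (meson Inf_lower2 ex_in_conv)
      ultimately show ?thesis
        unfolding field_r using mem by (auto intro!: bexI[of _ "Inf C"] Inf_lower)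
    qed
  qed
  then obtain M where "M \<in> Field ?r" and M_max: "\<forall>F\<in>Field ?r. (M, F) \<in> ?r \<longrightarrow> F = M"
    by (elim bexE)
  then have M: "M \<noteq> bot" "M \<le> cofinite"
    unfolding field_r by simp_all
  have max: "F = M" if "F \<noteq> bot" "F \<le> M" for F
    using M_max order_trans[OF that(2) M(2)] that M unfolding field_r by simp
  have "eventually P M \<or> eventually (\<lambda>m. \<not> P m) M" for P
  proof (rule disjCI)
    assume "\<not> eventually (\<lambda>m. \<not> P m) M"
    then have "inf M (principal {m. P m}) \<noteq> bot"
      by (simp add: trivial_limit_def eventually_inf_principal)
    then have "inf M (principal {m. P m}) = M" by (intro max) auto
    moreover have "eventually P (inf M (principal {m. P m}))"
      by (simp add: eventually_inf_principal)
    ultimately show "eventually P M" by simp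
  qed
  then show ?thesis using M unfolding nonprincipal_ultrafilter_def by blast
qed

definition uf :: "nat filter" where
  "uf = (SOME F. nonprincipal_ultrafilter F)"

lemma nonprincipal_ultrafilter_uf: "nonprincipal_ultrafilter uf"
  unfolding uf_def using nonprincipal_ultrafilter_exists by (rule someI_ex)

lemma uf_not_bot [simp]: "uf \<noteq> bot"
  using nonprincipal_ultrafilter_uf by (simp add: nonprincipal_ultrafilter_def)

lemma eventually_uf_not_iff: "eventually (\<lambda>m. \<not> P m) uf \<longleftrightarrow> \<not> eventually P uf"
proof -
  have "eventually P uf \<or> eventually (\<lambda>m. \<not> P m) uf"
    using nonprincipal_ultrafilter_uf by (simp add: nonprincipal_ultrafilter_def)
  moreover have "\<not> (eventually P uf \<and> eventually (\<lambda>m. \<not> P m) uf)"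
    using uf_not_bot by (auto simp: trivial_limit_def dest: eventually_conj)
  ultimately show ?thesis by blast
qed

lemma eventually_uf_disj_iff:
  "eventually (\<lambda>m. P m \<or> Q m) uf \<longleftrightarrow> eventually P uf \<or> eventually Q uf"
  using eventually_uf_not_iff[of "\<lambda>m. P m \<or> Q m"]
  by (auto simp: eventually_conj_iff eventually_uf_not_iff)

quotient_type 'a star = "nat \<Rightarrow> 'a" / "\<lambda>f g. eventually (\<lambda>m. f m = g m) uf"
proof (rule equivpI)
  show "reflp (\<lambda>f g. eventually (\<lambda>m. f m = (g m :: 'a)) uf)"
    by (simp add: reflp_def)
  show "symp (\<lambda>f g. eventually (\<lambda>m. f m = (g m :: 'a)) uf)"
    by (simp add: symp_def eq_commute)
  show "transp (\<lambda>f g. eventually (\<lambda>m. f m = (g m :: 'a)) uf)"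
    unfolding transp_def by (auto elim: eventually_elim2)
qed

lift_definition star_of :: "'a \<Rightarrow> 'a star" is "\<lambda>x m. x" .

instantiation star :: (zero) zero begin
lift_definition zero_star :: "'a star" is "\<lambda>m. 0" .
instance ..
end

instantiation star :: (one) one begin
lift_definition one_star :: "'a star" is "\<lambda>m. 1" .
instance ..
end

instantiation star :: (plus) plus begin
lift_definition plus_star :: "'a star \<Rightarrow> 'a star \<Rightarrow> 'a star" is "\<lambda>f g m. f m + g m"
  by (auto elim: eventually_elim2)
instance ..
end

instantiation star :: (minus) minus begin
lift_definition minus_star :: "'a star \<Rightarrow> 'a star \<Rightarrow> 'a star" is "\<lambda>f g m. f m - g m"
  by (auto elim: eventually_elim2)
instance ..
end

instantiation star :: (uminus) uminus begin
lift_definition uminus_star :: "'a star \<Rightarrow> 'a star" is "\<lambda>f m. - f m"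
  by (auto elim: eventually_mono)
instance ..
end

instantiation star :: (times) times begin
lift_definition times_star :: "'a star \<Rightarrow> 'a star \<Rightarrow> 'a star" is "\<lambda>f g m. f m * g m"
  by (auto elim: eventually_elim2)
instance ..
end

instantiation star :: (inverse) inverse begin
lift_definition inverse_star :: "'a star \<Rightarrow> 'a star" is "\<lambda>f m. inverse (f m)"
  by (auto elim: eventually_mono)
lift_definition divide_star :: "'a star \<Rightarrow> 'a star \<Rightarrow> 'a star" is "\<lambda>f g m. f m / g m"
  by (auto elim: eventually_elim2)
instance ..
end

instantiation star :: (ord) ord begin
lift_definition less_eq_star :: "'a star \<Rightarrow> 'a star \<Rightarrow> bool"
  is "\<lambda>f g. eventually (\<lambda>m. f m \<le> g m) uf"
  by (intro iffI; elim eventually_rev_mp; auto elim!: eventually_rev_mp intro!: always_eventually)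
lift_definition less_star :: "'a star \<Rightarrow> 'a star \<Rightarrow> bool"
  is "\<lambda>f g. eventually (\<lambda>m. f m < g m) uf"
  by (intro iffI; elim eventually_rev_mp; auto elim!: eventually_rev_mp intro!: always_eventually)
instance ..
end

instance star :: (linorder) linorder
proof
  fix x y z :: "'a star"
  show "x < y \<longleftrightarrow> x \<le> y \<and> \<not> y \<le> x"
    by transfer (auto simp: eventually_uf_not_iff[symmetric] not_le
        elim: eventually_mono)
  show "x \<le> x" by transfer simp
  show "x \<le> z" if "x \<le> y" "y \<le> z"
    using that by transfer (auto elim: eventually_elim2)
  show "x = y" if "x \<le> y" "y \<le> x"
    using that by transfer (auto elim: eventually_elim2)
  show "x \<le> y \<or> y \<le> x"
    by transfer (simp add: eventually_uf_disj_iff[symmetric] linear)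
qed

instance star :: (field) field
proof
  fix x y z :: "'a star"
  show "x + y + z = x + (y + z)" by transfer (simp add: add.assoc)
  show "x + y = y + x" by transfer (simp add: add.commute)
  show "0 + x = x" by transfer simp
  show "- x + x = 0" by transfer simp
  show "x - y = x + - y" by transfer simp
  show "x * y * z = x * (y * z)" by transfer (simp add: mult.assoc)
  show "x * y = y * x" by transfer (simp add: mult.commute)
  show "1 * x = x" by transfer simp
  show "(x + y) * z = x * z + y * z" by transfer (simp add: distrib_right)
  show "(0 :: 'a star) \<noteq> 1" by transfer simp
  show "inverse x * x = 1" if "x \<noteq> 0"
    using that by transfer (auto simp: eventually_uf_not_iff[symmetric] elim: eventually_mono)
  show "x / y = x * inverse y" by transfer (simp add: divide_inverse)
  show "inverse (0 :: 'a star) = 0" by transfer simp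
qed

lemma of_nat_star: "of_nat k = star_of (of_nat k :: 'a :: field)"
proof (induction k)
  case 0
  then show ?case by simp (transfer, simp)
next
  case (Suc k)
  then show ?case by simp (transfer, simp)
qed

instance star :: (field_char_0) field_char_0
proof
  show "inj (of_nat :: nat \<Rightarrow> 'a star)"
    by (rule injI, unfold of_nat_star, transfer) simp
qed

text \<open>The ground field ranges over the class \<^class>\<open>real_normed_field\<close>: by the theorems of Frobenius and
  Mazur its instances are, up to isometric isomorphism, exactly \<^typ>\<open>real\<close> and \<^typ>\<open>complex\<close>.\<close>

text \<open>The absolute value of a hyperreal or hypercomplex number, with values in the hyperreals.\<close>

lift_definition hnorm :: "'a :: real_normed_vector star \<Rightarrow> real star" is "\<lambda>f m. norm (f m)"
  by (auto elim: eventually_mono)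

definition infinitesimal :: "'a :: real_normed_vector star \<Rightarrow> bool" where
  "infinitesimal z \<longleftrightarrow> (\<forall>r > 0. hnorm z < star_of r)"


section \<open>Perturbations\<close>

definition star_mat :: "'a mat \<Rightarrow> 'a star mat" where
  "star_mat A = map_mat star_of A"

definition star_poly :: "'a :: zero poly \<Rightarrow> 'a star poly" where
  "star_poly p = map_poly star_of p"

definition infinitesimal_mat :: "nat \<Rightarrow> 'a :: real_normed_vector star mat \<Rightarrow> bool" where
  "infinitesimal_mat n E \<longleftrightarrow> E \<in> carrier_mat n n \<and> (\<forall>i<n. \<forall>j<n. infinitesimal (E $$ (i, j)))"

definition infinitesimal_poly :: "'a :: real_normed_field star poly \<Rightarrow> bool" where
  "infinitesimal_poly p \<longleftrightarrow> (\<forall>i. infinitesimal (coeff p i))"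

definition mat_perturbation ::
  "nat \<Rightarrow> 'a :: real_normed_field star mat \<Rightarrow> 'a mat \<Rightarrow> bool" where
  "mat_perturbation n B A \<longleftrightarrow>
     B \<in> carrier_mat n n \<and> A \<in> carrier_mat n n \<and> infinitesimal_mat n (B - star_mat A)"

definition poly_perturbation :: "'a :: real_normed_field star poly \<Rightarrow> 'a poly \<Rightarrow> bool" where
  "poly_perturbation q p \<longleftrightarrow> degree q = degree p \<and> infinitesimal_poly (q - star_poly p)"


section \<open>Sums of principal minors and their polarizations\<close>

definition Qsum :: "nat \<Rightarrow> 'a :: comm_ring_1 mat \<Rightarrow> 'a" where
  "Qsum k A = (\<Sum>S \<in> {S. S \<subseteq> {..<dim_row A} \<and> card S = k}. det (submatrix A S S))"

text \<open>A \<open>k\<close>-linear form on square matrices of order \<open>n\<close> takes the list of its \<open>k\<close> arguments;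
  its values on lists of any other shape are irrelevant.\<close>

definition mat_tuples :: "nat \<Rightarrow> nat \<Rightarrow> 'a mat list set" where
  "mat_tuples n k = {As. length As = k \<and> set As \<subseteq> carrier_mat n n}"

definition multilinear_form :: "nat \<Rightarrow> nat \<Rightarrow> ('a :: comm_ring_1 mat list \<Rightarrow> 'a) \<Rightarrow> bool" where
  "multilinear_form n k F \<longleftrightarrow>
     (\<forall>Xs Ys. \<forall>A \<in> carrier_mat n n. \<forall>B \<in> carrier_mat n n. \<forall>c.
        set Xs \<subseteq> carrier_mat n n \<longrightarrow> set Ys \<subseteq> carrier_mat n n \<longrightarrow>
        length Xs + 1 + length Ys = k \<longrightarrow>
          F (Xs @ [A + B] @ Ys) = F (Xs @ [A] @ Ys) + F (Xs @ [B] @ Ys) \<and>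
          F (Xs @ [c \<cdot>\<^sub>m A] @ Ys) = c * F (Xs @ [A] @ Ys))"

definition symmetric_form :: "nat \<Rightarrow> nat \<Rightarrow> ('a mat list \<Rightarrow> 'b) \<Rightarrow> bool" where
  "symmetric_form n k F \<longleftrightarrow>
     (\<forall>As \<in> mat_tuples n k. \<forall>Bs \<in> mat_tuples n k. mset As = mset Bs \<longrightarrow> F As = F Bs)"

definition polarizes_Qsum :: "nat \<Rightarrow> nat \<Rightarrow> ('a :: field_char_0 mat list \<Rightarrow> 'a) \<Rightarrow> bool" where
  "polarizes_Qsum n k F \<longleftrightarrow>
     multilinear_form n k F \<and> symmetric_form n k F \<and>
     (\<forall>A \<in> carrier_mat n n. F (replicate k A) = fact k * Qsum k A)"

lemma polarizes_Qsum_exists: "\<exists>F :: 'a :: field_char_0 mat list \<Rightarrow> 'a. polarizes_Qsum n k F"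
proof -
  define T :: "nat set \<Rightarrow> (nat \<Rightarrow> nat) \<Rightarrow> (nat \<Rightarrow> nat) \<Rightarrow> 'a mat list \<Rightarrow> 'a" where
    "T = (\<lambda>S p f As. \<Prod>i<k. (As ! f i) $$ (pick S i, pick S (p i)))"
  define I where "I = {S. S \<subseteq> {..<n} \<and> card S = k}"
  define P where "P = {p. p permutes {0..<k}}"
  define F where "F = (\<lambda>As. \<Sum>S\<in>I. \<Sum>p\<in>P. \<Sum>f\<in>P. signof p * T S p f As)"
  have pick_less: "pick S i < n" if "S \<in> I" "i < k" for S i
  proof (rule pick_le)
    have "{a. a < n \<and> a \<in> S} = S" using that by (auto simp: I_def)
    then show "i < card {a. a < n \<and> a \<in> S}" using that by (simp add: I_def)
  qed
  have P_less: "p i < k" if "p \<in> P" "i < k" for p i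
    using that permutes_in_image[of p "{0..<k}" i] by (auto simp: P_def)
  have slot: "\<exists>r s c. r < n \<and> s < n \<and> (\<forall>M. T S p f (Xs @ [M] @ Ys) = c * M $$ (r, s))"
    if S: "S \<in> I" and p: "p \<in> P" and "f \<in> P" and l: "length Xs + 1 + length Ys = k"
    for S p f Xs Ys
  proof -
    have f: "f permutes {0..<k}" using \<open>f \<in> P\<close> by (simp add: P_def)
    have "length Xs \<in> f ` {0..<k}" using permutes_image[OF f] l by simp
    then obtain i0 where i0: "i0 < k" "f i0 = length Xs" by auto
    have other: "(Xs @ [M] @ Ys) ! f i = (Xs @ [0\<^sub>m 0 0] @ Ys) ! f i" if "i \<noteq> i0" for i M
    proof -
      have "f i \<noteq> length Xs" using that i0 permutes_inj[OF f] by (metis injD)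
      then show ?thesis by (simp add: nth_append nth_Cons')
    qed
    have "T S p f (Xs @ [M] @ Ys) =
        (\<Prod>i\<in>{..<k} - {i0}. ((Xs @ [0\<^sub>m 0 0] @ Ys) ! f i) $$ (pick S i, pick S (p i))) *
        M $$ (pick S i0, pick S (p i0))" for M
    proof -
      have "T S p f (Xs @ [M] @ Ys) = ((Xs @ [M] @ Ys) ! f i0) $$ (pick S i0, pick S (p i0)) *
          (\<Prod>i\<in>{..<k} - {i0}. ((Xs @ [M] @ Ys) ! f i) $$ (pick S i, pick S (p i)))"
        unfolding T_def using i0 by (intro prod.remove) auto
      also have "(Xs @ [M] @ Ys) ! f i0 = M" using i0 by simp
      also have "(\<Prod>i\<in>{..<k} - {i0}. ((Xs @ [M] @ Ys) ! f i) $$ (pick S i, pick S (p i))) =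
          (\<Prod>i\<in>{..<k} - {i0}. ((Xs @ [0\<^sub>m 0 0] @ Ys) ! f i) $$ (pick S i, pick S (p i)))"
        by (rule prod.cong[OF refl], subst other) auto
      finally show ?thesis by (simp only: mult.commute)
    qed
    then show ?thesis
      using pick_less[OF S] P_less[OF p] i0(1) by blast
  qed
  have "multilinear_form n k F"
    unfolding multilinear_form_def
  proof (intro allI ballI impI conjI)
    fix Xs Ys :: "'a mat list" and A B :: "'a mat" and c :: 'a
    assume A: "A \<in> carrier_mat n n" and B: "B \<in> carrier_mat n n"
      and l: "length Xs + 1 + length Ys = k"
    have "T S p f (Xs @ [A + B] @ Ys) = T S p f (Xs @ [A] @ Ys) + T S p f (Xs @ [B] @ Ys)"
      if m: "S \<in> I" "p \<in> P" "f \<in> P" for S p f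
    proof -
      obtain r s d where "r < n" "s < n" "\<And>M. T S p f (Xs @ [M] @ Ys) = d * M $$ (r, s)"
        using slot[OF m l] by blast
      then show ?thesis using A B by (simp only: carrier_matD index_add_mat distrib_left)
    qed
    then show "F (Xs @ [A + B] @ Ys) = F (Xs @ [A] @ Ys) + F (Xs @ [B] @ Ys)"
      unfolding F_def sum.distrib[symmetric]
      by (intro sum.cong refl) (simp only: distrib_left)
    have "T S p f (Xs @ [c \<cdot>\<^sub>m A] @ Ys) = c * T S p f (Xs @ [A] @ Ys)"
      if m: "S \<in> I" "p \<in> P" "f \<in> P" for S p f
    proof -
      obtain r s d where "r < n" "s < n" "\<And>M. T S p f (Xs @ [M] @ Ys) = d * M $$ (r, s)"
        using slot[OF m l] by blast
      then show ?thesis using A by (simp only: carrier_matD index_smult_mat mult.left_commute)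
    qed
    then show "F (Xs @ [c \<cdot>\<^sub>m A] @ Ys) = c * F (Xs @ [A] @ Ys)"
      unfolding F_def sum_distrib_left
      by (intro sum.cong refl) (simp only: mult.left_commute)
  qed
  moreover have "symmetric_form n k F"
    unfolding symmetric_form_def
  proof (intro ballI impI)
    fix As Bs :: "'a mat list"
    assume As: "As \<in> mat_tuples n k" and Bs: "Bs \<in> mat_tuples n k" and eq: "mset As = mset Bs"
    obtain q where q: "q permutes {..<length Bs}" "permute_list q Bs = As"
      using mset_eq_permutation[OF eq] by blast
    have l: "length Bs = k" using Bs by (simp add: mat_tuples_def)
    have q': "q permutes {0..<k}" using q l by (simp add: atLeast0LessThan)
    have "T S p f As = T S p (q \<circ> f) Bs" if "f \<in> P" for S p f
    proof -
      have "As ! f i = Bs ! (q \<circ> f) i" if "i < k" for i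
        using permute_list_nth[OF q(1), of "f i"] P_less[OF \<open>f \<in> P\<close> that] q(2) l by simp
      then show ?thesis unfolding T_def by (simp cong: prod.cong_simp)
    qed
    then have "(\<Sum>f\<in>P. signof p * T S p f As) = (\<Sum>f\<in>P. signof p * T S p (q \<circ> f) Bs)" for S p
      by (intro sum.cong refl) simp
    also have "(\<Sum>f\<in>P. signof p * T S p (q \<circ> f) Bs) = (\<Sum>f\<in>P. signof p * T S p f Bs)" for S p
      unfolding P_def
      by (rule setum_permutations_compose_left[OF q', of "\<lambda>f. signof p * T S p f Bs", symmetric])
    finally show "F As = F Bs" unfolding F_def by (simp only:)
  qed
  moreover have "F (replicate k A) = fact k * Qsum k A" if A: "A \<in> carrier_mat n n" for A
  proof -
    have cardP: "card P = fact k" unfolding P_def by (subst card_permutations[of _ k]) auto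
    have d: "det (submatrix A S S) =
        (\<Sum>p\<in>P. signof p * (\<Prod>i<k. A $$ (pick S i, pick S (p i))))" if S: "S \<in> I" for S
    proof -
      have eqS: "{i. i < n \<and> i \<in> S} = S" using S by (auto simp: I_def)
      have c: "submatrix A S S = mat k k (\<lambda>(i, j). A $$ (pick S i, pick S j))"
        using A S unfolding submatrix_def by (simp add: eqS I_def)
      have "det (submatrix A S S) = (\<Sum>p\<in>P. signof p *
          (\<Prod>i<k. mat k k (\<lambda>(i, j). A $$ (pick S i, pick S j)) $$ (i, p i)))"
        unfolding c det_def P_def by (simp add: atLeast0LessThan)
      also have "\<dots> = (\<Sum>p\<in>P. signof p * (\<Prod>i<k. A $$ (pick S i, pick S (p i))))"
      proof (rule sum.cong[OF refl])
        fix p assume p: "p \<in> P"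
        have "(\<Prod>i<k. mat k k (\<lambda>(i, j). A $$ (pick S i, pick S j)) $$ (i, p i)) =
            (\<Prod>i<k. A $$ (pick S i, pick S (p i)))"
          by (rule prod.cong) (simp_all add: P_less[OF p])
        then show "signof p * (\<Prod>i<k. mat k k (\<lambda>(i, j). A $$ (pick S i, pick S j)) $$ (i, p i)) =
            signof p * (\<Prod>i<k. A $$ (pick S i, pick S (p i)))" by (simp only:)
      qed
      finally show ?thesis .
    qed
    have t: "T S p f (replicate k A) = (\<Prod>i<k. A $$ (pick S i, pick S (p i)))"
      if "f \<in> P" for S p f
      unfolding T_def using P_less[OF that] by (intro prod.cong) auto
    have "F (replicate k A) = (\<Sum>S\<in>I. fact k * det (submatrix A S S))"
      unfolding F_def by (intro sum.cong refl) (simp add: t d cardP sum_distrib_left cong: sum.cong)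
    also have "\<dots> = fact k * Qsum k A"
      using A by (simp add: Qsum_def I_def sum_distrib_left)
    finally show ?thesis .
  qed
  ultimately show ?thesis unfolding polarizes_Qsum_def by blast
qed

text \<open>On \<^term>\<open>mat_tuples n k\<close> the chosen form is unique, by polarization.\<close>

definition Theta :: "nat \<Rightarrow> nat \<Rightarrow> 'a :: field_char_0 mat list \<Rightarrow> 'a" where
  "Theta n k = (SOME F. polarizes_Qsum n k F)"

text \<open>The extension by multilinearity to matrices over the nonstandard extension; it is determined
  on \<^term>\<open>mat_tuples n k\<close> by its values on tuples of matrix units.\<close>

definition Theta_star :: "nat \<Rightarrow> nat \<Rightarrow> 'a :: field_char_0 star mat list \<Rightarrow> 'a star" where
  "Theta_star n k = (SOME F. multilinear_form n k F \<and>
     (\<forall>As \<in> mat_tuples n k. F (map star_mat As) = star_of (Theta n k As)))"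


section \<open>Linear combinations of matrices\<close>

definition lincomb_mat :: "nat \<Rightarrow> nat \<Rightarrow> (nat \<Rightarrow> 'a :: comm_ring_1) \<Rightarrow> (nat \<Rightarrow> 'a mat) \<Rightarrow> 'a mat" where
  "lincomb_mat n l c U = mat n n (\<lambda>(p, q). \<Sum>i=1..l. c i * U i $$ (p, q))"

definition lin_indep_mats :: "nat \<Rightarrow> nat \<Rightarrow> (nat \<Rightarrow> 'a :: field mat) \<Rightarrow> bool" where
  "lin_indep_mats n l U \<longleftrightarrow>
     (\<forall>c. lincomb_mat n l c U = 0\<^sub>m n n \<longrightarrow> (\<forall>i \<in> {1..l}. c i = 0))"

end

theory Submission
  imports Defs
begin

text \<open>Expanding \<open>det (X Id - A)\<close> by Leibniz and sorting the terms by the set of rows in which the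
  entry of \<open>A\<close> is chosen expresses the coefficients of the characteristic polynomial by the sums
  \<open>Q\<^sup>(\<^sup>k\<^sup>)\<close> of principal minors. The expansion of \<open>Q\<^sup>(\<^sup>k\<^sup>)(A + E)\<close> is the binomial formula for a symmetric
  multilinear form, once the extension of the polarization \<open>\<Theta>\<close> to the nonstandard field is known to
  polarize \<open>Q\<^sup>(\<^sup>k\<^sup>)\<close> there: a polarization over the nonstandard field restricts to \<open>\<Theta>\<close> on standard matrices,
  because symmetric additive forms are determined by their diagonal, and multilinear forms are
  determined by their values on standard matrices, because these contain the matrix units. Finally
  \<open>E = \<alpha>\<^sub>1(U\<^sub>1 + D)\<close> with \<open>D\<close> infinitesimal, and multilinear forms that are finite on matrix units
  are finite on finite matrices and infinitesimal if one argument is.\<close>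

section \<open>The characteristic polynomial and principal minors\<close>

text \<open>\<open>submatrix\<close> renumbers the rows in S through \<open>pick S\<close>.
  Conjugation by this bijection turns permutations of \<open>{0..<k}\<close> into permutations of S
  and keeps the sign. The resulting sum no longer mentions the numbering, so minors can be compared
  with a full Leibniz sum and moved along \<open>star_of\<close>.\<close>

lemma det_principal_submatrix:
  fixes A :: "'a :: comm_ring_1 mat"
  assumes A: "A \<in> carrier_mat n n" and S: "S \<subseteq> {..<n}"
  shows "det (submatrix A S S) = (\<Sum>p | p permutes S. signof p * (\<Prod>i\<in>S. A $$ (i, p i)))"
proof -
  define k where "k = card S"
  let ?f = "pick S" and ?m = "map_permutation {0..<k} (pick S)"
  have fin: "finite S" using S finite_subset by blast
  have inj: "inj_on ?f {0..<k}"
    unfolding k_def by (rule linorder_inj_onI) (use pick_mono_le in \<open>force simp: less_le\<close>)+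
  have "?f ` {0..<k} \<subseteq> S" using pick_in_set_le by (auto simp: k_def)
  then have img: "?f ` {0..<k} = S"
    using fin inj by (intro card_subset_eq) (auto simp: card_image k_def)
  have bij: "bij_betw ?f {0..<k} S" using inj img by (simp add: bij_betw_def)
  \<comment> \<open>With the image equal to S, \<open>map_permutation\<close> takes the shape in
    which \<open>bij_betw_permutations\<close> states its bijection.\<close>
  have "?m = (\<lambda>p x. if x \<in> S then ?f (p (inv_into {0..<k} ?f x)) else x)"
    by (auto simp: fun_eq_iff map_permutation_def restrict_id_def img)
  then have bij_m: "bij_betw ?m {p. p permutes {0..<k}} {p. p permutes S}"
    using bij_betw_permutations[OF bij] by simp
  have eqS: "{i. i < n \<and> i \<in> S} = S" using S by auto
  have sub: "submatrix A S S = mat k k (\<lambda>(i, j). A $$ (?f i, ?f j))"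
    using A unfolding submatrix_def by (simp add: eqS k_def)
  have "det (submatrix A S S) =
      (\<Sum>p | p permutes {0..<k}. signof p * (\<Prod>i\<in>{0..<k}. A $$ (?f i, ?f (p i))))"
    unfolding sub det_def
    by (auto intro!: sum.cong prod.cong arg_cong2[where f = "(*)"]
        simp: permutes_in_image[where S = "{0..<k}", simplified])
  also have "\<dots> = (\<Sum>p | p permutes {0..<k}. signof (?m p) * (\<Prod>i\<in>S. A $$ (i, ?m p i)))"
  proof (intro sum.cong refl)
    fix p assume "p \<in> {p. p permutes {0..<k}}"
    then have p: "p permutes {0..<k}" by simp
    have "(\<Prod>i\<in>S. A $$ (i, ?m p i)) = (\<Prod>i\<in>{0..<k}. A $$ (?f i, ?m p (?f i)))"
      using prod.reindex_bij_betw[OF bij, of "\<lambda>i. A $$ (i, ?m p i)"] by simp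
    then show "signof p * (\<Prod>i\<in>{0..<k}. A $$ (?f i, ?f (p i))) =
        signof (?m p) * (\<Prod>i\<in>S. A $$ (i, ?m p i))"
      using sign_map_permutation[OF inj p] by (simp add: map_permutation_apply[OF inj])
  qed
  also have "\<dots> = (\<Sum>p | p permutes S. signof p * (\<Prod>i\<in>S. A $$ (i, p i)))"
    by (rule sum.reindex_bij_betw[OF bij_m])
  finally show ?thesis .
qed

lemma prod_const_poly: "(\<Prod>i\<in>S. [:f i:]) = [:\<Prod>i\<in>S. f i :: 'a :: comm_ring_1:]"
  by (induction S rule: infinite_finite_induct) simp_all

text \<open>In the Leibniz sum each factor splits into the constant \<open>- A $$ (i, p i)\<close>
  and an X that occurs only if p fixes i. After multiplying out, S is the set of rows where the
  constant is taken; every other row contributes X and must be fixed by p, so p permutes S.\<close>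

lemma char_poly_eq_sum_principal_minors:
  fixes A :: "'a :: comm_ring_1 mat"
  assumes A: "A \<in> carrier_mat n n"
  shows "char_poly A =
    (\<Sum>S\<in>Pow {..<n}. monom ((-1) ^ card S * det (submatrix A S S)) (n - card S))"
proof -
  let ?U = "{..<n}"
  let ?a = "\<lambda>p i. [:- (A $$ (i, p i)):]" and ?d = "\<lambda>p i. if p i = i then [:0, 1:] else (0 :: 'a poly)"
  have "char_poly A = (\<Sum>p | p permutes ?U. signof p * (\<Prod>i\<in>?U. ?a p i + ?d p i))"
  proof -
    have "char_poly A = (\<Sum>p | p permutes ?U. signof p * (\<Prod>i\<in>?U. char_poly_matrix A $$ (i, p i)))"
      unfolding char_poly_def by (subst det_def'[OF char_poly_matrix_closed[OF A]])
        (simp add: atLeast0LessThan)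
    also have "\<dots> = (\<Sum>p | p permutes ?U. signof p * (\<Prod>i\<in>?U. ?a p i + ?d p i))"
      using A by (intro sum.cong refl arg_cong2[where f = "(*)"] prod.cong)
        (auto simp: char_poly_matrix_def permutes_in_image[where S = ?U, simplified])
    finally show ?thesis .
  qed
  also have "\<dots> = (\<Sum>p | p permutes ?U. \<Sum>S\<in>Pow ?U.
      signof p * ((\<Prod>i\<in>S. ?a p i) * (\<Prod>i\<in>?U - S. ?d p i)))"
    by (simp add: prod_add sum_distrib_left)
  also have "\<dots> = (\<Sum>S\<in>Pow ?U. \<Sum>p | p permutes ?U.
      signof p * ((\<Prod>i\<in>S. ?a p i) * (\<Prod>i\<in>?U - S. ?d p i)))"
    by (rule sum.swap)
  also have "\<dots> = (\<Sum>S\<in>Pow ?U. monom ((-1) ^ card S * det (submatrix A S S)) (n - card S))"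
  proof (rule sum.cong[OF refl])
    fix S assume "S \<in> Pow ?U"
    then have S: "S \<subseteq> ?U" by simp
    then have fin: "finite S" using finite_subset by blast
    \<comment> \<open>A permutation that moves a row outside S has a zero factor there, so only
      permutations of S survive.\<close>
    have "(\<Sum>p | p permutes ?U. signof p * ((\<Prod>i\<in>S. ?a p i) * (\<Prod>i\<in>?U - S. ?d p i))) =
        (\<Sum>p | p permutes S. signof p * ((\<Prod>i\<in>S. ?a p i) * (\<Prod>i\<in>?U - S. ?d p i)))"
    proof (rule sum.mono_neutral_right)
      show "{p. p permutes S} \<subseteq> {p. p permutes ?U}" using S permutes_subset by blast
      show "\<forall>p\<in>{p. p permutes ?U} - {p. p permutes S}.
          signof p * ((\<Prod>i\<in>S. ?a p i) * (\<Prod>i\<in>?U - S. ?d p i)) = 0"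
      proof
        fix p assume p: "p \<in> {p. p permutes ?U} - {p. p permutes S}"
        then obtain i where "i \<in> ?U - S" "p i \<noteq> i" using permutes_superset[of p ?U S] by auto
        then have "(\<Prod>i\<in>?U - S. ?d p i) = 0" by (intro prod_zero) auto
        then show "signof p * ((\<Prod>i\<in>S. ?a p i) * (\<Prod>i\<in>?U - S. ?d p i)) = 0" by simp
      qed
    qed (simp add: finite_permutations)
    also have "\<dots> = (\<Sum>p | p permutes S.
        monom ((-1) ^ card S * (signof p * (\<Prod>i\<in>S. A $$ (i, p i)))) (n - card S))"
    proof (rule sum.cong[OF refl])
      fix p assume "p \<in> {p. p permutes S}"
      then have p: "p permutes S" by simp
      have "(\<Prod>i\<in>?U - S. ?d p i) = (\<Prod>i\<in>?U - S. [:0, 1:])"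
        using permutes_not_in[OF p] by (intro prod.cong) auto
      also have "\<dots> = monom 1 (n - card S)"
        using S fin by (simp add: card_Diff_subset x_as_monom monom_power)
      finally have d: "(\<Prod>i\<in>?U - S. ?d p i) = monom 1 (n - card S)" .
      \<comment> \<open>The sign taken in the polynomial ring is a constant polynomial, so the whole
        summand is a single monomial.\<close>
      have s: "(signof p :: 'a poly) = [:signof p:]"
        by (simp add: of_int_poly)
      show "signof p * ((\<Prod>i\<in>S. ?a p i) * (\<Prod>i\<in>?U - S. ?d p i)) =
          monom ((-1) ^ card S * (signof p * (\<Prod>i\<in>S. A $$ (i, p i)))) (n - card S)"
        unfolding d prod_const_poly s
        by (simp add: prod_uminus smult_monom mult_ac)
    qed
    also have "\<dots> = monom ((-1) ^ card S * det (submatrix A S S)) (n - card S)"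
      unfolding det_principal_submatrix[OF A S] sum_distrib_left monom_hom.hom_sum ..
    finally show "(\<Sum>p | p permutes ?U. signof p * ((\<Prod>i\<in>S. ?a p i) * (\<Prod>i\<in>?U - S. ?d p i))) =
        monom ((-1) ^ card S * det (submatrix A S S)) (n - card S)" .
  qed
  finally show ?thesis .
qed

text \<open>The subsets S are grouped by cardinality; the class of cardinality 0 gives the leading
  term.\<close>

lemma char_poly_eq_sum_Qsum:
  fixes A :: "'a :: comm_ring_1 mat"
  assumes A: "A \<in> carrier_mat n n"
  shows "char_poly A = monom 1 n + (\<Sum>j=1..n. monom ((-1) ^ j * Qsum j A) (n - j))"
proof -
  let ?I = "\<lambda>j. {S. S \<subseteq> {..<n} \<and> card S = j}"
  have "char_poly A = (\<Sum>j\<in>{..n}. \<Sum>S | S \<in> Pow {..<n} \<and> card S = j.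
      monom ((-1) ^ card S * det (submatrix A S S)) (n - card S))"
    unfolding char_poly_eq_sum_principal_minors[OF A]
    by (rule sum.group[symmetric]) (auto intro: card_mono[of "{..<n}", simplified])
  also have "\<dots> = (\<Sum>j\<in>{..n}. monom ((-1) ^ j * Qsum j A) (n - j))"
  proof (rule sum.cong[OF refl])
    fix j
    have "(\<Sum>S | S \<in> Pow {..<n} \<and> card S = j.
          monom ((-1) ^ card S * det (submatrix A S S)) (n - card S)) =
        (\<Sum>S\<in>?I j. monom ((-1) ^ j * det (submatrix A S S)) (n - j))"
      by (intro sum.cong) auto
    then show "(\<Sum>S | S \<in> Pow {..<n} \<and> card S = j.
          monom ((-1) ^ card S * det (submatrix A S S)) (n - card S)) =
        monom ((-1) ^ j * Qsum j A) (n - j)"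
      using A by (simp add: Qsum_def sum_distrib_left monom_hom.hom_sum)
  qed
  also have "\<dots> = monom (Qsum 0 A) n + (\<Sum>j=1..n. monom ((-1) ^ j * Qsum j A) (n - j))"
    by (simp add: atMost_atLeast0 sum.atLeast_Suc_atMost)
  \<comment> \<open>\<open>card\<close> is also 0 on infinite sets, which the bound n excludes; the
    remaining empty minor is an empty product.\<close>
  also have "Qsum 0 A = 1"
  proof -
    have "{S. S \<subseteq> {..<n} \<and> card S = 0} = {{}}" by (auto dest: finite_subset)
    then show ?thesis using A det_principal_submatrix[OF A, of "{}"] by (simp add: Qsum_def)
  qed
  finally show ?thesis .
qed

section \<open>Symmetric additive forms\<close>

text \<open>Additivity is isolated because the form of interest sends matrices over the base field
  to the nonstandard field, whereas \<open>multilinear_form\<close> takes values in the ring of the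
  entries.\<close>

definition additive_form :: "nat \<Rightarrow> nat \<Rightarrow> ('a :: plus mat list \<Rightarrow> 'b :: plus) \<Rightarrow> bool" where
  "additive_form n k H \<longleftrightarrow>
     (\<forall>Xs Ys. \<forall>A \<in> carrier_mat n n. \<forall>B \<in> carrier_mat n n.
        set Xs \<subseteq> carrier_mat n n \<longrightarrow> set Ys \<subseteq> carrier_mat n n \<longrightarrow>
        length Xs + 1 + length Ys = k \<longrightarrow>
          H (Xs @ [A + B] @ Ys) = H (Xs @ [A] @ Ys) + H (Xs @ [B] @ Ys))"

lemma additive_formD:
  assumes "additive_form n k H" "A \<in> carrier_mat n n" "B \<in> carrier_mat n n"
    "set Xs \<subseteq> carrier_mat n n" "set Ys \<subseteq> carrier_mat n n" "length Xs + 1 + length Ys = k"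
  shows "H (Xs @ (A + B) # Ys) = H (Xs @ A # Ys) + H (Xs @ B # Ys)"
  using assms unfolding additive_form_def by simp

lemma multilinear_formD:
  assumes "multilinear_form n k F" "A \<in> carrier_mat n n" "B \<in> carrier_mat n n"
    "set Xs \<subseteq> carrier_mat n n" "set Ys \<subseteq> carrier_mat n n" "length Xs + 1 + length Ys = k"
  shows "F (Xs @ (A + B) # Ys) = F (Xs @ A # Ys) + F (Xs @ B # Ys)"
    and "F (Xs @ (c \<cdot>\<^sub>m A) # Ys) = c * F (Xs @ A # Ys)"
proof -
  have "F (Xs @ [A + B] @ Ys) = F (Xs @ [A] @ Ys) + F (Xs @ [B] @ Ys)"
    and "F (Xs @ [c \<cdot>\<^sub>m A] @ Ys) = c * F (Xs @ [A] @ Ys)"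
    using assms unfolding multilinear_form_def by blast+
  then show "F (Xs @ (A + B) # Ys) = F (Xs @ A # Ys) + F (Xs @ B # Ys)"
    and "F (Xs @ (c \<cdot>\<^sub>m A) # Ys) = c * F (Xs @ A # Ys)" by simp_all
qed

lemma additive_form_multilinear: "multilinear_form n k F \<Longrightarrow> additive_form n k F"
  unfolding multilinear_form_def additive_form_def by blast

lemma symmetric_formD:
  assumes "symmetric_form n k H" "set As \<subseteq> carrier_mat n n" "length As = k" "mset As = mset Bs"
  shows "H As = H Bs"
proof -
  have "set Bs = set As" using mset_eq_setD[OF assms(4)] by simp
  moreover have "length Bs = length As" using mset_eq_length[OF assms(4)] by simp
  ultimately have "As \<in> mat_tuples n k" "Bs \<in> mat_tuples n k"
    using assms(2,3) by (auto simp: mat_tuples_def)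
  then show ?thesis using assms(1,4) unfolding symmetric_form_def by blast
qed

text \<open>Induction on m by Pascal's rule: one copy of X + Y is opened at a time, and the prefix
  As absorbs the argument chosen.\<close>

lemma additive_form_binomial:
  fixes H :: "'a :: plus mat list \<Rightarrow> 'b :: semiring_1"
  assumes add: "additive_form n k H" and sym: "symmetric_form n k H"
    and X: "X \<in> carrier_mat n n" and Y: "Y \<in> carrier_mat n n"
    and "set As \<subseteq> carrier_mat n n" "length As + m = k"
  shows "H (As @ replicate m (X + Y)) =
    (\<Sum>i\<le>m. of_nat (m choose i) * H (As @ replicate (m - i) X @ replicate i Y))"
  using assms(5,6)
proof (induction m arbitrary: As)
  case 0
  then show ?case by simp
next
  case (Suc m)
  define a where "a i = H (As @ replicate (Suc m - i) X @ replicate i Y)" for i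
  have XY: "X + Y \<in> carrier_mat n n" using Y by simp
  have "H (As @ replicate (Suc m) (X + Y)) =
      H ((As @ [X]) @ replicate m (X + Y)) + H ((As @ [Y]) @ replicate m (X + Y))"
    using additive_formD[OF add X Y, of As "replicate m (X + Y)"] Suc.prems XY
    by (simp add: set_replicate_conv_if)
  also have "H ((As @ [X]) @ replicate m (X + Y)) = (\<Sum>i\<le>m. of_nat (m choose i) * a i)"
    by (subst Suc.IH) (use Suc.prems X in \<open>auto simp: a_def Suc_diff_le\<close>)
  \<comment> \<open>By symmetry the chosen Y joins the other copies of Y, which shifts the index of
    \<open>a\<close> by one.\<close>
  also have "H ((As @ [Y]) @ replicate m (X + Y)) = (\<Sum>i\<le>m. of_nat (m choose i) * a (Suc i))"
  proof -
    have "H ((As @ [Y]) @ replicate (m - i) X @ replicate i Y) = a (Suc i)" if "i \<le> m" for i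
      unfolding a_def by (rule symmetric_formD[OF sym])
        (use that Suc.prems X Y in \<open>auto simp: set_replicate_conv_if\<close>)
    then show ?thesis by (subst Suc.IH) (use Suc.prems Y in auto)
  qed
  also have "(\<Sum>i\<le>m. of_nat (m choose i) * a i) + (\<Sum>i\<le>m. of_nat (m choose i) * a (Suc i)) =
      (\<Sum>i\<le>Suc m. of_nat (Suc m choose i) * a i)"
  proof -
    \<comment> \<open>The extra summand has binomial coefficient 0; it gives both sums the same
      range for Pascal's rule.\<close>
    have "(\<Sum>i\<le>m. of_nat (m choose i) * a i) = (\<Sum>i\<le>Suc m. of_nat (m choose i) * a i)"
      by (simp add: binomial_eq_0)
    also have "\<dots> = a 0 + (\<Sum>i\<le>m. of_nat (m choose Suc i) * a (Suc i))"
      by (subst sum.atMost_Suc_shift) simp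
    finally show ?thesis
      unfolding sum.atMost_Suc_shift[of _ m] by (simp add: sum.distrib distrib_right add_ac)
  qed
  finally show ?case unfolding a_def .
qed

lemma poly_eq_0_if_zero_on_nat:
  fixes p :: "'a :: field_char_0 poly"
  assumes "\<And>t :: nat. poly p (of_nat t) = 0"
  shows "p = 0"
proof (rule ccontr)
  assume "p \<noteq> 0"
  then have "finite {x. poly p x = 0}" by (rule poly_roots_finite)
  moreover have "range of_nat \<subseteq> {x. poly p x = 0}" using assms by auto
  ultimately have "finite (range (of_nat :: nat \<Rightarrow> 'a))" by (rule rev_finite_subset)
  then show False by (simp add: range_inj_infinite inj_of_nat)
qed

text \<open>Additivity yields homogeneity for natural scalars; in characteristic 0 these are enough
  points to identify a polynomial in t.\<close>

lemma additive_form_of_nat_smult: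
  fixes H :: "'a :: comm_ring_1 mat list \<Rightarrow> 'b :: comm_ring_1"
  assumes add: "additive_form n k H" and Y: "Y \<in> carrier_mat n n"
    and l: "set Xs \<subseteq> carrier_mat n n" "set Ys \<subseteq> carrier_mat n n" "length Xs + 1 + length Ys = k"
  shows "H (Xs @ (of_nat t \<cdot>\<^sub>m Y) # Ys) = of_nat t * H (Xs @ Y # Ys)"
proof (induction t)
  case 0
  have Z: "0 \<cdot>\<^sub>m Y \<in> carrier_mat n n" using Y by simp
  have "0 \<cdot>\<^sub>m Y + 0 \<cdot>\<^sub>m Y = 0 \<cdot>\<^sub>m Y" by (intro eq_matI) auto
  then show ?case using additive_formD[OF add Z Z l] by simp
next
  case (Suc t)
  have Z: "of_nat t \<cdot>\<^sub>m Y \<in> carrier_mat n n" using Y by simp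
  have "of_nat (Suc t) \<cdot>\<^sub>m Y = Y + of_nat t \<cdot>\<^sub>m Y" by (intro eq_matI) (auto simp: distrib_right)
  then show ?case using additive_formD[OF add Y Z l] Suc.IH by (simp add: distrib_right)
qed

lemma additive_form_of_nat_smult_replicate:
  fixes H :: "'a :: comm_ring_1 mat list \<Rightarrow> 'b :: comm_ring_1"
  assumes add: "additive_form n k H" and Y: "Y \<in> carrier_mat n n"
    and "set As \<subseteq> carrier_mat n n" "length As + i = k"
  shows "H (As @ replicate i (of_nat t \<cdot>\<^sub>m Y)) = of_nat t ^ i * H (As @ replicate i Y)"
  using assms(3,4)
proof (induction i arbitrary: As)
  case (Suc i)
  have "H (As @ replicate (Suc i) (of_nat t \<cdot>\<^sub>m Y)) =
      of_nat t * H ((As @ [Y]) @ replicate i (of_nat t \<cdot>\<^sub>m Y))"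
    using additive_form_of_nat_smult[OF add Y, of As "replicate i (of_nat t \<cdot>\<^sub>m Y)" t] Suc.prems Y
    by (simp add: set_replicate_conv_if)
  then show ?case using Suc.prems Y by (subst (asm) Suc.IH) (simp_all add: mult_ac)
qed simp

text \<open>Replacing \<open>X\<close> by \<open>X + tY\<close> on the diagonal gives a polynomial in \<open>t\<close> that vanishes at all
  natural numbers; its linear coefficient is a multiple of the value with one slot \<open>Y\<close>.\<close>

lemma additive_form_eq_0_if_diagonal_0:
  fixes H :: "'a :: comm_ring_1 mat list \<Rightarrow> 'b :: field_char_0"
  assumes add: "additive_form n k H" and sym: "symmetric_form n k H"
    and diag: "\<And>X. X \<in> carrier_mat n n \<Longrightarrow> H (replicate k X) = 0"
    and As: "set As \<subseteq> carrier_mat n n" "length As = k"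
  shows "H As = 0"
proof -
  \<comment> \<open>The claim is generalized to lists with a constant tail. Induction removes the
    last entry of the head, and the hypothesis then covers the longer tail with any matrix, in
    particular X + tY.\<close>
  have "H (As @ replicate m X) = 0"
    if "set As \<subseteq> carrier_mat n n" "length As + m = k" "X \<in> carrier_mat n n" for As m X
    using that
  proof (induction As arbitrary: m X rule: rev_induct)
    case Nil
    then show ?case using diag by simp
  next
    case (snoc Y Bs)
    let ?m = "Suc m"
    define a where "a i = H (Bs @ replicate (?m - i) X @ replicate i Y)" for i
    \<comment> \<open>By powers of t, p collects the binomial expansion of H at Bs followed by
      copies of X + tY.\<close>
    define p where "p = (\<Sum>i\<le>?m. monom (of_nat (?m choose i) * a i) i)"
    have Y: "Y \<in> carrier_mat n n" and X: "X \<in> carrier_mat n n" and Bs: "set Bs \<subseteq> carrier_mat n n"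
      and l: "length Bs + ?m = k" using snoc.prems by auto
    have "poly p (of_nat t) = 0" for t
    proof -
      have tY: "of_nat t \<cdot>\<^sub>m Y \<in> carrier_mat n n" using Y by simp
      have "0 = H (Bs @ replicate ?m (X + of_nat t \<cdot>\<^sub>m Y))"
        using snoc.IH[OF Bs l, of "X + of_nat t \<cdot>\<^sub>m Y"] X tY by simp
      also have "\<dots> = (\<Sum>i\<le>?m. of_nat (?m choose i) *
          H (Bs @ replicate (?m - i) X @ replicate i (of_nat t \<cdot>\<^sub>m Y)))"
        by (rule additive_form_binomial[OF add sym X tY Bs l])
      also have "\<dots> = (\<Sum>i\<le>?m. of_nat (?m choose i) * (of_nat t ^ i * a i))"
      proof (intro sum.cong refl arg_cong2[where f = "(*)"])
        fix i assume "i \<in> {..?m}"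
        then show "H (Bs @ replicate (?m - i) X @ replicate i (of_nat t \<cdot>\<^sub>m Y)) = of_nat t ^ i * a i"
          unfolding a_def
          using additive_form_of_nat_smult_replicate[OF add Y, of "Bs @ replicate (?m - i) X" i t] Bs X l
          by (auto simp: set_replicate_conv_if)
      qed
      also have "\<dots> = poly p (of_nat t)"
        by (simp only: p_def poly_sum poly_monom mult_ac)
      finally show ?thesis by simp
    qed
    then have "p = 0" by (rule poly_eq_0_if_zero_on_nat)
    then have "coeff p 1 = 0" by simp
    \<comment> \<open>The factor \<open>Suc m\<close> is nonzero in characteristic 0, so
      \<open>a 1\<close> vanishes; up to the order of the arguments it is the value wanted.\<close>
    also have "coeff p 1 = of_nat ?m * a 1"
      by (simp add: p_def coeff_sum if_distrib cong: if_cong)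
    finally have "a 1 = 0" using of_nat_neq_0[of m, where 'a = 'b] by simp
    moreover have "H ((Bs @ [Y]) @ replicate m X) = a 1"
      unfolding a_def by (rule symmetric_formD[OF sym])
        (use l X Y Bs in \<open>auto simp: set_replicate_conv_if\<close>)
    ultimately show ?case by simp
  qed
  from this[of As 0 "0\<^sub>m n n"] show ?thesis using As by simp
qed

section \<open>Polarization over the nonstandard field\<close>

interpretation star_of: field_hom "star_of :: 'a :: field \<Rightarrow> 'a star"
proof
  fix x y :: 'a
  show "star_of (x + y) = star_of x + star_of y" by transfer simp
  show "star_of (x * y) = star_of x * star_of y" by transfer simp
  show "star_of (0 :: 'a) = 0" by transfer simp
  show "star_of (1 :: 'a) = 1" by transfer simp
qed

lemma star_mat_carrier [simp]: "star_mat A \<in> carrier_mat n m \<longleftrightarrow> A \<in> carrier_mat n m"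
  by (auto simp: star_mat_def)

lemma star_mat_add:
  fixes A B :: "'a :: field mat"
  assumes "A \<in> carrier_mat n m" "B \<in> carrier_mat n m"
  shows "star_mat (A + B) = star_mat A + star_mat B"
  using assms by (intro eq_matI) (auto simp: star_mat_def star_of.hom_add)

lemma star_poly_char_poly:
  fixes A :: "'a :: field mat"
  assumes "A \<in> carrier_mat n n"
  shows "star_poly (char_poly A) = char_poly (star_mat A)"
  using star_of.char_poly_hom[OF assms] by (simp add: star_poly_def star_mat_def)

lemma Qsum_star_mat:
  fixes A :: "'a :: field mat"
  assumes A: "A \<in> carrier_mat n n"
  shows "Qsum k (star_mat A) = star_of (Qsum k A)"
proof -
  have "det (submatrix (star_mat A) S S) = star_of (det (submatrix A S S))" if S: "S \<subseteq> {..<n}" for S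
  proof -
    have A': "star_mat A \<in> carrier_mat n n" using A by simp
    have "star_mat A $$ (i, p i) = star_of (A $$ (i, p i))" if "p permutes S" "i \<in> S" for p i
    proof -
      have "i < n" "p i < n" using that S permutes_in_image[of p S i] by auto
      then show ?thesis using A by (simp add: star_mat_def)
    qed
    then show ?thesis
      unfolding det_principal_submatrix[OF A S] det_principal_submatrix[OF A' S] star_of.hom_sum
      by (intro sum.cong refl) (simp add: star_of.hom_mult star_of.hom_prod star_of.hom_of_int)
  qed
  moreover have "dim_row (star_mat A) = dim_row A" by (simp add: star_mat_def)
  ultimately show ?thesis using A by (simp add: Qsum_def star_of.hom_sum)
qed

lemma polarizes_Qsum_Theta: "polarizes_Qsum n k (Theta n k)"
  unfolding Theta_def using polarizes_Qsum_exists by (rule someI_ex)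

text \<open>The difference of both sides is symmetric and additive in matrices over the base field,
  and its diagonal vanishes because \<open>star_of\<close> commutes with \<open>Qsum\<close>. So
  every polarization over the nonstandard field extends \<open>Theta\<close>.\<close>

lemma polarizes_Qsum_star_mat:
  fixes F :: "'a :: field_char_0 star mat list \<Rightarrow> 'a star"
  assumes F: "polarizes_Qsum n k F" and As: "As \<in> mat_tuples n k"
  shows "F (map star_mat As) = star_of (Theta n k As)"
proof -
  let ?H = "\<lambda>As. F (map star_mat As) - star_of (Theta n k As)"
  have T: "polarizes_Qsum n k (Theta n k :: 'a mat list \<Rightarrow> 'a)" by (rule polarizes_Qsum_Theta)
  have addF: "additive_form n k F" and addT: "additive_form n k (Theta n k :: 'a mat list \<Rightarrow> 'a)"
    using F T by (auto simp: polarizes_Qsum_def intro: additive_form_multilinear)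
  have symF: "symmetric_form n k F" and symT: "symmetric_form n k (Theta n k :: 'a mat list \<Rightarrow> 'a)"
    using F T by (auto simp: polarizes_Qsum_def)
  have "additive_form n k ?H"
    unfolding additive_form_def
  proof (intro allI ballI impI)
    fix Xs Ys :: "'a mat list" and A B :: "'a mat"
    assume *: "A \<in> carrier_mat n n" "B \<in> carrier_mat n n" "set Xs \<subseteq> carrier_mat n n"
      "set Ys \<subseteq> carrier_mat n n" "length Xs + 1 + length Ys = k"
    have "set (map star_mat Xs) \<subseteq> carrier_mat n n" "set (map star_mat Ys) \<subseteq> carrier_mat n n"
      using * by auto
    then show "?H (Xs @ [A + B] @ Ys) = ?H (Xs @ [A] @ Ys) + ?H (Xs @ [B] @ Ys)"
      using additive_formD[OF addT *] * 
        additive_formD[OF addF, of "star_mat A" "star_mat B" "map star_mat Xs" "map star_mat Ys"]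
      by (simp add: star_mat_add star_of.hom_add)
  qed
  moreover have "symmetric_form n k ?H"
    unfolding symmetric_form_def
  proof (intro ballI impI)
    fix As Bs :: "'a mat list"
    assume *: "As \<in> mat_tuples n k" "Bs \<in> mat_tuples n k" "mset As = mset Bs"
    have "F (map star_mat As) = F (map star_mat Bs)"
    proof (rule symmetric_formD[OF symF])
      show "set (map star_mat As) \<subseteq> carrier_mat n n" "length (map star_mat As) = k"
        using *(1) by (auto simp: mat_tuples_def)
    qed (simp add: *(3))
    moreover have "Theta n k As = Theta n k Bs"
      using symT * unfolding symmetric_form_def by blast
    ultimately show "?H As = ?H Bs" by simp
  qed
  moreover have "?H (replicate k X) = 0" if X: "X \<in> carrier_mat n n" for X
  proof -
    have "F (replicate k (star_mat X)) = fact k * Qsum k (star_mat X)"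
      using F X by (auto simp: polarizes_Qsum_def)
    moreover have "Theta n k (replicate k X) = fact k * Qsum k X"
      using T X by (auto simp: polarizes_Qsum_def)
    moreover have "fact k = star_of (fact k :: 'a)"
      by (metis of_nat_fact of_nat_star)
    ultimately show ?thesis by (simp add: Qsum_star_mat[OF X] star_of.hom_mult)
  qed
  ultimately have "?H As = 0"
    by (rule additive_form_eq_0_if_diagonal_0) (use As in \<open>auto simp: mat_tuples_def\<close>)
  then show ?thesis by simp
qed

section \<open>Expansion of multilinear forms in matrix units\<close>

definition matrix_unit :: "nat \<Rightarrow> nat \<times> nat \<Rightarrow> 'a :: zero_neq_one mat" where
  "matrix_unit n ij = mat n n (\<lambda>ab. if ab = ij then 1 else 0)"

lemma matrix_unit_carrier [simp]: "matrix_unit n ij \<in> carrier_mat n n"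
  by (simp add: matrix_unit_def)

text \<open>This lets an expansion in matrix units replace a nonstandard argument by standard
  ones.\<close>

lemma star_mat_matrix_unit: "star_mat (matrix_unit n ij) = (matrix_unit n ij :: 'a :: field star mat)"
  by (intro eq_matI) (auto simp: star_mat_def matrix_unit_def)

lemma multilinear_form_expand_slot:
  assumes F: "multilinear_form n k F" and X: "X \<in> carrier_mat n n"
    and l: "set Xs \<subseteq> carrier_mat n n" "set Ys \<subseteq> carrier_mat n n" "length Xs + 1 + length Ys = k"
  shows "F (Xs @ X # Ys) = (\<Sum>ij\<in>{..<n} \<times> {..<n}. X $$ ij * F (Xs @ matrix_unit n ij # Ys))"
proof -
  \<comment> \<open>\<open>P I\<close> keeps the entries of X at the positions in I; adding one
    position at a time leads from the zero matrix to X.\<close>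
  define P where "P I = mat n n (\<lambda>ab. if ab \<in> I then X $$ ab else 0)" for I
  have P: "P I \<in> carrier_mat n n" for I by (simp add: P_def)
  have "F (Xs @ P I # Ys) = (\<Sum>ij\<in>I. X $$ ij * F (Xs @ matrix_unit n ij # Ys))" if "finite I" for I
    using that
  proof (induction I)
    case empty
    \<comment> \<open>The zero matrix is written as 0 times itself so that homogeneity makes the
      value 0.\<close>
    have "P {} = 0 \<cdot>\<^sub>m P {}" by (intro eq_matI) (auto simp: P_def)
    then have "F (Xs @ P {} # Ys) = F (Xs @ (0 \<cdot>\<^sub>m P {}) # Ys)" by simp
    then show ?case using multilinear_formD(2)[OF F P P l] by simp
  next
    case (insert ij I)
    have "P (insert ij I) = X $$ ij \<cdot>\<^sub>m matrix_unit n ij + P I"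
      using insert.hyps(2) by (intro eq_matI) (auto simp: P_def matrix_unit_def)
    then show ?case
      using multilinear_formD(1)[OF F _ P l, of "X $$ ij \<cdot>\<^sub>m matrix_unit n ij"]
        multilinear_formD(2)[OF F matrix_unit_carrier matrix_unit_carrier l] insert
      by simp
  qed
  moreover have "P ({..<n} \<times> {..<n}) = X" using X by (intro eq_matI) (auto simp: P_def)
  ultimately show ?thesis by (metis finite_cartesian_product finite_lessThan)
qed

lemma multilinear_form_eq_if_eq_on_standard:
  fixes F G :: "'a :: field star mat list \<Rightarrow> 'a star"
  assumes F: "multilinear_form n k F" and G: "multilinear_form n k G"
    and eq: "\<And>As. As \<in> mat_tuples n k \<Longrightarrow> F (map star_mat As) = G (map star_mat As)"
    and Xs: "Xs \<in> mat_tuples n k"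
  shows "F Xs = G Xs"
proof -
  \<comment> \<open>The list is split into an arbitrary head and a standard tail. Expanding the last
    head entry in matrix units turns it into standard matrices, which join the tail.\<close>
  have "F (Xs @ map star_mat Ys) = G (Xs @ map star_mat Ys)"
    if "set Xs \<subseteq> carrier_mat n n" "set Ys \<subseteq> carrier_mat n n" "length Xs + length Ys = k" for Xs Ys
    using that
  proof (induction Xs arbitrary: Ys rule: rev_induct)
    case Nil
    then show ?case using eq by (simp add: mat_tuples_def)
  next
    case (snoc X Xs)
    have "F (Xs @ matrix_unit n ij # map star_mat Ys) = G (Xs @ matrix_unit n ij # map star_mat Ys)" for ij
      using snoc.IH[of "matrix_unit n ij # Ys"] snoc.prems by (simp add: star_mat_matrix_unit)
    moreover have "set (map star_mat Ys) \<subseteq> carrier_mat n n" using snoc.prems by auto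
    ultimately show ?case
      using snoc.prems multilinear_form_expand_slot[OF F, of X Xs "map star_mat Ys"]
        multilinear_form_expand_slot[OF G, of X Xs "map star_mat Ys"] by simp
  qed
  from this[of Xs "[]"] show ?thesis using Xs by (simp add: mat_tuples_def)
qed

text \<open>The choice by \<open>SOME\<close> needs a witness: any polarization of
  \<open>Qsum\<close> over the nonstandard field serves.\<close>

lemma Theta_star:
  shows multilinear_Theta_star: "multilinear_form n k (Theta_star n k :: 'a :: field_char_0 star mat list \<Rightarrow> 'a star)"
    and Theta_star_star_mat: "As \<in> mat_tuples n k \<Longrightarrow>
      Theta_star n k (map star_mat As) = star_of (Theta n k As :: 'a)"
proof -
  let ?P = "\<lambda>F :: 'a star mat list \<Rightarrow> 'a star. multilinear_form n k F \<and>
     (\<forall>As \<in> mat_tuples n k. F (map star_mat As) = star_of (Theta n k As))"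
  obtain F :: "'a star mat list \<Rightarrow> 'a star" where "polarizes_Qsum n k F"
    using polarizes_Qsum_exists by blast
  then have "?P F" using polarizes_Qsum_star_mat by (auto simp: polarizes_Qsum_def)
  then have *: "?P (Theta_star n k)" unfolding Theta_star_def by (rule someI[of ?P])
  show "multilinear_form n k (Theta_star n k :: 'a star mat list \<Rightarrow> 'a star)" using * by blast
  show "As \<in> mat_tuples n k \<Longrightarrow> Theta_star n k (map star_mat As) = star_of (Theta n k As :: 'a)"
    using * by blast
qed

text \<open>Symmetry and the diagonal values are not part of the definition of
  \<open>Theta_star\<close>. They are inherited from a polarization F over the nonstandard field:
  both forms extend \<open>Theta\<close>, hence agree on all tuples.\<close>

lemma polarizes_Qsum_Theta_star:
  "polarizes_Qsum n k (Theta_star n k :: 'a :: field_char_0 star mat list \<Rightarrow> 'a star)"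
proof -
  obtain F :: "'a star mat list \<Rightarrow> 'a star" where F: "polarizes_Qsum n k F"
    using polarizes_Qsum_exists by blast
  have eq: "Theta_star n k As = F As" if "As \<in> mat_tuples n k" for As
    by (rule multilinear_form_eq_if_eq_on_standard[OF multilinear_Theta_star _ _ that])
      (use F in \<open>auto simp: Theta_star_star_mat polarizes_Qsum_star_mat polarizes_Qsum_def\<close>)
  have "symmetric_form n k F" using F by (simp add: polarizes_Qsum_def)
  then have "symmetric_form n k (Theta_star n k :: 'a star mat list \<Rightarrow> 'a star)"
    unfolding symmetric_form_def by (metis eq)
  moreover have "Theta_star n k (replicate k A) = fact k * Qsum k A" if "A \<in> carrier_mat n n"
    for A :: "'a star mat"
  proof -
    have "replicate k A \<in> mat_tuples n k" using that by (auto simp: mat_tuples_def)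
    then show ?thesis using F that by (simp add: eq polarizes_Qsum_def)
  qed
  ultimately show ?thesis by (simp add: polarizes_Qsum_def multilinear_Theta_star)
qed

text \<open>The binomial formula on the diagonal, divided by k!; the term i = 0 is
  \<open>Qsum k X\<close>.\<close>

lemma Qsum_add:
  fixes X Y :: "'a :: field_char_0 mat"
  assumes F: "polarizes_Qsum n k F" and X: "X \<in> carrier_mat n n" and Y: "Y \<in> carrier_mat n n"
  shows "Qsum k (X + Y) = Qsum k X +
    (\<Sum>i=1..k. 1 / (fact i * fact (k - i)) * F (replicate (k - i) X @ replicate i Y))"
proof -
  let ?T = "\<lambda>i. F (replicate (k - i) X @ replicate i Y)"
  have add: "additive_form n k F" and sym: "symmetric_form n k F"
    and diag: "\<And>A. A \<in> carrier_mat n n \<Longrightarrow> F (replicate k A) = fact k * Qsum k A"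
    using F by (auto simp: polarizes_Qsum_def intro: additive_form_multilinear)
  have "fact k * Qsum k (X + Y) = (\<Sum>i\<le>k. of_nat (k choose i) * ?T i)"
    using additive_form_binomial[OF add sym X Y, of "[]" k] diag[of "X + Y"] Y by simp
  also have "\<dots> = (\<Sum>i\<le>k. fact k * (1 / (fact i * fact (k - i)) * ?T i))"
    by (intro sum.cong refl) (simp add: binomial_fact)
  also have "\<dots> = fact k * (\<Sum>i\<le>k. 1 / (fact i * fact (k - i)) * ?T i)"
    by (simp only: sum_distrib_left)
  finally have "Qsum k (X + Y) = (\<Sum>i\<le>k. 1 / (fact i * fact (k - i)) * ?T i)" by simp
  also have "\<dots> = Qsum k X + (\<Sum>i=1..k. 1 / (fact i * fact (k - i)) * ?T i)"
    by (simp add: atMost_atLeast0 sum.atLeast_Suc_atMost diag[OF X])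
  finally show ?thesis .
qed

section \<open>Finite and infinitesimal values\<close>

text \<open>The finite elements form a ring containing the standard ones, with the infinitesimals as
  an ideal; the estimates below rest on these closure rules.\<close>

definition hfinite :: "'a :: real_normed_vector star \<Rightarrow> bool" where
  "hfinite z \<longleftrightarrow> (\<exists>r > 0. hnorm z < star_of r)"

lemma hnorm_add_less:
  "hnorm x < star_of r \<Longrightarrow> hnorm y < star_of s \<Longrightarrow> hnorm (x + y) < star_of (r + s)"
  by transfer (erule (1) eventually_elim2, rule norm_add_less)

lemma hnorm_mult_less:
  fixes x y :: "'a :: real_normed_field star"
  shows "hnorm x < star_of r \<Longrightarrow> hnorm y < star_of s \<Longrightarrow> hnorm (x * y) < star_of (r * s)"
  by transfer (erule (1) eventually_elim2, rule norm_mult_less)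

lemma infinitesimalD: "infinitesimal z \<Longrightarrow> r > 0 \<Longrightarrow> hnorm z < star_of r"
  by (simp add: infinitesimal_def)

lemma infinitesimal_imp_hfinite: "infinitesimal z \<Longrightarrow> hfinite z"
  unfolding hfinite_def infinitesimal_def using gt_ex[of "0 :: real"] by blast

lemma hfinite_star_of [simp]: "hfinite (star_of x)"
proof -
  have "hnorm (star_of x) < star_of (norm x + 1)" by transfer simp
  moreover have "norm x + 1 > 0" by (rule add_nonneg_pos) simp_all
  ultimately show ?thesis unfolding hfinite_def by blast
qed

lemma infinitesimal_0 [simp]: "infinitesimal 0"
  unfolding infinitesimal_def by (intro allI impI, transfer) simp

lemma infinitesimal_add:
  assumes "infinitesimal x" "infinitesimal y"
  shows "infinitesimal (x + y)"
  unfolding infinitesimal_def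
proof (intro allI impI)
  fix r :: real assume "r > 0"
  then show "hnorm (x + y) < star_of r"
    using hnorm_add_less[OF infinitesimalD infinitesimalD, OF assms(1) _ assms(2), of "r/2" "r/2"]
    by simp
qed

lemma hfinite_add: "hfinite x \<Longrightarrow> hfinite y \<Longrightarrow> hfinite (x + y)"
  unfolding hfinite_def by (elim exE conjE) (rule exI, rule conjI[OF add_pos_pos hnorm_add_less])

lemma infinitesimal_mult_hfinite:
  fixes x y :: "'a :: real_normed_field star"
  assumes "infinitesimal x" "hfinite y"
  shows "infinitesimal (x * y)"
  unfolding infinitesimal_def
proof (intro allI impI)
  fix r :: real assume "r > 0"
  obtain s where "s > 0" "hnorm y < star_of s" using assms(2) by (auto simp: hfinite_def)
  then show "hnorm (x * y) < star_of r"
    using hnorm_mult_less[OF infinitesimalD[OF assms(1)], of "r / s" y s] \<open>r > 0\<close> by simp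
qed

lemma hfinite_mult_infinitesimal:
  fixes x y :: "'a :: real_normed_field star"
  shows "hfinite x \<Longrightarrow> infinitesimal y \<Longrightarrow> infinitesimal (x * y)"
  using infinitesimal_mult_hfinite[of y x] by (simp add: mult.commute)

lemma hfinite_mult:
  fixes x y :: "'a :: real_normed_field star"
  shows "hfinite x \<Longrightarrow> hfinite y \<Longrightarrow> hfinite (x * y)"
  unfolding hfinite_def by (elim exE conjE) (rule exI, rule conjI[OF mult_pos_pos hnorm_mult_less])

lemma hfinite_power:
  fixes x :: "'a :: real_normed_field star"
  shows "hfinite x \<Longrightarrow> hfinite (x ^ i)"
  using hfinite_star_of[of "1 :: 'a"] by (induction i) (auto intro: hfinite_mult)

lemma infinitesimal_power:
  fixes x :: "'a :: real_normed_field star"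
  assumes "infinitesimal x" "i > 0"
  shows "infinitesimal (x ^ i)"
  using assms hfinite_power[OF infinitesimal_imp_hfinite]
  by (cases i) (auto intro: infinitesimal_mult_hfinite)

lemma infinitesimal_sum:
  fixes f :: "'b \<Rightarrow> 'a :: real_normed_field star"
  shows "(\<And>i. i \<in> I \<Longrightarrow> infinitesimal (f i)) \<Longrightarrow> infinitesimal (\<Sum>i\<in>I. f i)"
  by (induction I rule: infinite_finite_induct) (auto intro: infinitesimal_add)

lemma hfinite_sum:
  fixes f :: "'b \<Rightarrow> 'a :: real_normed_field star"
  shows "(\<And>i. i \<in> I \<Longrightarrow> hfinite (f i)) \<Longrightarrow> hfinite (\<Sum>i\<in>I. f i)"
  by (induction I rule: infinite_finite_induct)
    (auto intro: hfinite_add infinitesimal_imp_hfinite)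

lemma hfinite_prod:
  fixes f :: "'b \<Rightarrow> 'a :: real_normed_field star"
  shows "(\<And>i. i \<in> I \<Longrightarrow> hfinite (f i)) \<Longrightarrow> hfinite (\<Prod>i\<in>I. f i)"
  using hfinite_star_of[of "1 :: 'a"]
  by (induction I rule: infinite_finite_induct) (simp_all add: hfinite_mult)

text \<open>The coefficients of the expansion are standard, hence finite.\<close>

lemma one_div_fact_mult_fact_star:
  "(1 / (fact i * fact j) :: 'a :: field_char_0 star) = star_of (1 / (fact i * fact j))"
proof -
  have "fact m = star_of (fact m :: 'a)" for m by (metis of_nat_fact of_nat_star)
  then show ?thesis by (simp add: star_of.hom_div star_of.hom_mult)
qed

section \<open>Values of the polarization on finite and infinitesimal matrices\<close>

definition hfinite_mat :: "nat \<Rightarrow> 'a :: real_normed_vector star mat \<Rightarrow> bool" where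
  "hfinite_mat n X \<longleftrightarrow> X \<in> carrier_mat n n \<and> (\<forall>i<n. \<forall>j<n. hfinite (X $$ (i, j)))"

lemma hfinite_mat_star_mat: "A \<in> carrier_mat n n \<Longrightarrow> hfinite_mat n (star_mat A)"
  by (auto simp: hfinite_mat_def star_mat_def)

lemma infinitesimal_mat_imp_hfinite_mat: "infinitesimal_mat n E \<Longrightarrow> hfinite_mat n E"
  by (auto simp: hfinite_mat_def infinitesimal_mat_def intro: infinitesimal_imp_hfinite)

lemma hfinite_mat_add:
  fixes X Y :: "'a :: real_normed_field star mat"
  shows "hfinite_mat n X \<Longrightarrow> hfinite_mat n Y \<Longrightarrow> hfinite_mat n (X + Y)"
  by (auto simp: hfinite_mat_def hfinite_add)

text \<open>On standard tuples the values are standard. Arbitrary finite arguments are reduced to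
  these from the back, each expansion in matrix units being a sum of products of finite
  elements.\<close>

lemma hfinite_Theta_star:
  fixes Xs :: "'a :: real_normed_field star mat list"
  assumes "\<And>X. X \<in> set Xs \<Longrightarrow> hfinite_mat n X" "length Xs = k"
  shows "hfinite (Theta_star n k Xs)"
proof -
  have "hfinite (Theta_star n k (Xs @ map star_mat Ys))"
    if "\<And>X. X \<in> set Xs \<Longrightarrow> hfinite_mat n X" "set Ys \<subseteq> carrier_mat n n" "length Xs + length Ys = k"
    for Xs and Ys :: "'a mat list"
    using that
  proof (induction Xs arbitrary: Ys rule: rev_induct)
    case Nil
    then show ?case by (simp add: Theta_star_star_mat mat_tuples_def)
  next
    case (snoc X Xs)
    let ?Ys = "map star_mat Ys"
    have X: "hfinite_mat n X" using snoc.prems by simp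
    have unit: "hfinite (Theta_star n k (Xs @ matrix_unit n ij # ?Ys))" for ij
      using snoc.IH[of "matrix_unit n ij # Ys"] snoc.prems by (simp add: star_mat_matrix_unit)
    have "set Xs \<subseteq> carrier_mat n n" "set ?Ys \<subseteq> carrier_mat n n" "X \<in> carrier_mat n n"
      using snoc.prems by (auto simp: hfinite_mat_def)
    then have "Theta_star n k (Xs @ X # ?Ys) =
        (\<Sum>ij\<in>{..<n} \<times> {..<n}. X $$ ij * Theta_star n k (Xs @ matrix_unit n ij # ?Ys))"
      using snoc.prems by (intro multilinear_form_expand_slot[OF multilinear_Theta_star]) auto
    moreover have "hfinite \<dots>"
      by (intro hfinite_sum hfinite_mult unit) (use X in \<open>auto simp: hfinite_mat_def\<close>)
    ultimately show ?case by simp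
  qed
  from this[of Xs "[]"] show ?thesis using assms by simp
qed

text \<open>Expanding the last slot gives infinitesimal entries of D times values that are finite
  because matrix units are finite.\<close>

lemma infinitesimal_Theta_star:
  fixes Xs :: "'a :: real_normed_field star mat list"
  assumes "\<And>X. X \<in> set Xs \<Longrightarrow> hfinite_mat n X" "infinitesimal_mat n D" "length Xs + 1 = k"
  shows "infinitesimal (Theta_star n k (Xs @ [D]))"
proof -
  have unit: "hfinite_mat n (matrix_unit n ij :: 'a star mat)" for ij
    using hfinite_mat_star_mat[of "matrix_unit n ij :: 'a mat"] by (simp add: star_mat_matrix_unit)
  have "Theta_star n k (Xs @ [D]) =
      (\<Sum>ij\<in>{..<n} \<times> {..<n}. D $$ ij * Theta_star n k (Xs @ [matrix_unit n ij]))"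
    using assms by (intro multilinear_form_expand_slot[OF multilinear_Theta_star])
      (auto simp: infinitesimal_mat_def hfinite_mat_def)
  moreover have "infinitesimal \<dots>"
    by (intro infinitesimal_sum infinitesimal_mult_hfinite hfinite_Theta_star)
      (use assms unit in \<open>auto simp: infinitesimal_mat_def\<close>)
  ultimately show ?thesis by simp
qed

section \<open>Comparison of characteristic polynomials\<close>

lemma infinitesimal_poly_sum_monom:
  assumes "\<And>k. k \<in> I \<Longrightarrow> infinitesimal (c k)"
  shows "infinitesimal_poly (\<Sum>k\<in>I. monom (c k) (d k))"
  unfolding infinitesimal_poly_def coeff_sum
  using assms by (auto intro!: infinitesimal_sum)

lemma char_poly_diff:
  fixes A B :: "'a :: comm_ring_1 mat"
  assumes "A \<in> carrier_mat n n" "B \<in> carrier_mat n n"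
  shows "char_poly A - char_poly B = (\<Sum>k=1..n. monom ((-1) ^ k * (Qsum k A - Qsum k B)) (n - k))"
  unfolding char_poly_eq_sum_Qsum[OF assms(1)] char_poly_eq_sum_Qsum[OF assms(2)]
  by (simp add: right_diff_distrib diff_monom[symmetric] sum_subtractf)

lemma hfinite_minus_one_power [simp]: "hfinite ((-1) ^ k :: 'a :: real_normed_field star)"
  using hfinite_star_of[of "(-1) ^ k :: 'a"] by (simp add: star_of.hom_power star_of.hom_uminus)

lemma infinitesimal_Qsum_diff:
  fixes A :: "'a :: real_normed_field mat"
  assumes A: "A \<in> carrier_mat n n" and E: "infinitesimal_mat n E"
  shows "infinitesimal (Qsum k (star_mat A + E) - Qsum k (star_mat A))"
proof -
  have "star_mat A \<in> carrier_mat n n" "E \<in> carrier_mat n n"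
    using A E by (auto simp: infinitesimal_mat_def)
  then have "Qsum k (star_mat A + E) - Qsum k (star_mat A) =
      (\<Sum>i=1..k. 1 / (fact i * fact (k - i)) *
        Theta_star n k (replicate (k - i) (star_mat A) @ replicate i E))"
    by (simp add: Qsum_add[OF polarizes_Qsum_Theta_star])
  also have "infinitesimal \<dots>"
  proof (intro infinitesimal_sum hfinite_mult_infinitesimal)
    fix i assume i: "i \<in> {1..k}"
    \<comment> \<open>The sum starts at i = 1, so every term has at least one argument E, which is
      split off as the last one.\<close>
    then obtain j where j: "i = Suc j" by (cases i) auto
    have "infinitesimal (Theta_star n k ((replicate (k - i) (star_mat A) @ replicate j E) @ [E]))"
      by (rule infinitesimal_Theta_star)
        (use A E i j in \<open>auto simp: hfinite_mat_star_mat infinitesimal_mat_imp_hfinite_mat\<close>)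
    then show "infinitesimal (Theta_star n k (replicate (k - i) (star_mat A) @ replicate i E))"
      by (simp add: j replicate_append_same)
  qed (simp add: one_div_fact_mult_fact_star)
  finally show ?thesis .
qed

text \<open>Both polynomials are monic of degree n, and their coefficients differ by signed
  differences of the sums of minors.\<close>

lemma poly_perturbation_char_poly:
  fixes A :: "'a :: real_normed_field mat"
  assumes A: "A \<in> carrier_mat n n" and E: "infinitesimal_mat n E"
  shows "poly_perturbation (char_poly (star_mat A + E)) (char_poly A)"
proof -
  have AE: "star_mat A + E \<in> carrier_mat n n" using E by (auto simp: infinitesimal_mat_def)
  have "infinitesimal_poly (char_poly (star_mat A + E) - char_poly (star_mat A))"
    by (subst char_poly_diff[OF AE]) (use A E in
      \<open>auto intro!: infinitesimal_poly_sum_monom hfinite_mult_infinitesimal infinitesimal_Qsum_diff\<close>)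
  then show ?thesis
    using degree_monic_char_poly[OF AE] degree_monic_char_poly[OF A]
    by (simp add: poly_perturbation_def star_poly_char_poly[OF A])
qed

lemma multilinear_form_smult_replicate:
  assumes F: "multilinear_form n k F" and Y: "Y \<in> carrier_mat n n"
    and "set As \<subseteq> carrier_mat n n" "length As + i = k"
  shows "F (As @ replicate i (c \<cdot>\<^sub>m Y)) = c ^ i * F (As @ replicate i Y)"
  using assms(3,4)
proof (induction i arbitrary: As)
  case (Suc i)
  have "F (As @ replicate (Suc i) (c \<cdot>\<^sub>m Y)) = c * F ((As @ [Y]) @ replicate i (c \<cdot>\<^sub>m Y))"
    using multilinear_formD(2)[OF F Y Y, of As "replicate i (c \<cdot>\<^sub>m Y)" c] Suc.prems Y
    by (simp add: set_replicate_conv_if)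
  then show ?case using Suc.prems Y by (subst (asm) Suc.IH) (simp_all add: mult_ac)
qed simp

section \<open>First order approximation\<close>

text \<open>With V = U + D the i-th term of the expansion carries \<alpha> to the power i. One
  factor \<alpha> is pulled out of every term rather than divided off, so \<alpha> = 0 is covered as
  well.\<close>

lemma Qsum_first_order:
  fixes A U :: "'a :: real_normed_field mat"
  assumes A: "A \<in> carrier_mat n n" and U: "U \<in> carrier_mat n n" and D: "infinitesimal_mat n D"
    and \<alpha>: "infinitesimal \<alpha>" and k: "k \<ge> 1"
  shows "\<exists>r. infinitesimal r \<and>
    Qsum k (star_mat A + \<alpha> \<cdot>\<^sub>m (star_mat U + D)) - Qsum k (star_mat A) =
      \<alpha> * (1 / fact (k - 1) * Theta_star n k (replicate (k - 1) (star_mat A) @ [star_mat U]) + r)"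
proof -
  define V where "V = star_mat U + D"
  have D': "D \<in> carrier_mat n n" using D by (simp add: infinitesimal_mat_def)
  have V: "V \<in> carrier_mat n n" using D' by (simp add: V_def)
  have finV: "hfinite_mat n V"
    unfolding V_def using U D by (intro hfinite_mat_add hfinite_mat_star_mat infinitesimal_mat_imp_hfinite_mat)
  define A' where "A' = star_mat A"
  have A': "A' \<in> carrier_mat n n" and finA: "hfinite_mat n A'"
    using A by (simp_all add: A'_def hfinite_mat_star_mat)
  let ?T = "\<lambda>i. Theta_star n k (replicate (k - i) A' @ replicate i V)"
  let ?c = "\<lambda>i. 1 / (fact i * fact (k - i)) :: 'a star"
  \<comment> \<open>The remainder consists of the D part of the linear term and of the terms i \<ge>
    2, which keep a positive power of \<alpha>.\<close>
  define r where "r = ?c 1 * Theta_star n k (replicate (k - 1) A' @ [D]) +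
    (\<Sum>i=2..k. ?c i * (\<alpha> ^ (i - 1) * ?T i))"
  have "infinitesimal r"
    unfolding r_def
  proof (intro infinitesimal_add infinitesimal_sum)
    have "infinitesimal (Theta_star n k (replicate (k - 1) A' @ [D]))"
      by (rule infinitesimal_Theta_star) (use finA D k in auto)
    then show "infinitesimal (?c 1 * Theta_star n k (replicate (k - 1) A' @ [D]))"
      unfolding one_div_fact_mult_fact_star by (rule hfinite_mult_infinitesimal[OF hfinite_star_of])
  next
    fix i assume i: "i \<in> {2..k}"
    have "infinitesimal (\<alpha> ^ (i - 1))" by (rule infinitesimal_power[OF \<alpha>]) (use i in auto)
    moreover have "hfinite (?T i)" by (rule hfinite_Theta_star) (use i finA finV in auto)
    ultimately show "infinitesimal (?c i * (\<alpha> ^ (i - 1) * ?T i))"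
      unfolding one_div_fact_mult_fact_star
      by (intro hfinite_mult_infinitesimal[OF hfinite_star_of] infinitesimal_mult_hfinite)
  qed
  moreover have "Qsum k (A' + \<alpha> \<cdot>\<^sub>m V) - Qsum k A' =
      \<alpha> * (1 / fact (k - 1) * Theta_star n k (replicate (k - 1) A' @ [star_mat U]) + r)"
  proof -
    have "Qsum k (A' + \<alpha> \<cdot>\<^sub>m V) - Qsum k A' =
        (\<Sum>i=1..k. ?c i * Theta_star n k (replicate (k - i) A' @ replicate i (\<alpha> \<cdot>\<^sub>m V)))"
      using A' V by (simp add: Qsum_add[OF polarizes_Qsum_Theta_star])
    also have "\<dots> = (\<Sum>i=1..k. ?c i * (\<alpha> ^ i * ?T i))"
      using A' V by (intro sum.cong refl, subst multilinear_form_smult_replicate[OF multilinear_Theta_star])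
        (auto simp: set_replicate_conv_if)
    also have "\<dots> = ?c 1 * (\<alpha> * ?T 1) + (\<Sum>i=2..k. ?c i * (\<alpha> ^ i * ?T i))"
      using k by (simp add: sum.atLeast_Suc_atMost numeral_2_eq_2)
    also have "(\<Sum>i=2..k. ?c i * (\<alpha> ^ i * ?T i)) = \<alpha> * (\<Sum>i=2..k. ?c i * (\<alpha> ^ (i - 1) * ?T i))"
      unfolding sum_distrib_left
    proof (intro sum.cong refl)
      fix i assume "i \<in> {2..k}"
      then have "\<alpha> ^ i = \<alpha> * \<alpha> ^ (i - 1)" by (cases i) auto
      then show "?c i * (\<alpha> ^ i * ?T i) = \<alpha> * (?c i * (\<alpha> ^ (i - 1) * ?T i))"
        by (simp only: mult_ac)
    qed
    \<comment> \<open>Linearity in the single slot V separates the principal term at U from the part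
      at D that goes into r.\<close>
    also have "?T 1 = Theta_star n k (replicate (k - 1) A' @ [star_mat U]) +
        Theta_star n k (replicate (k - 1) A' @ [D])"
      using multilinear_formD(1)[OF multilinear_Theta_star, of "star_mat U" n D "replicate (k - 1) A'" "[]" k]
        U D' A' k by (auto simp: V_def set_replicate_conv_if)
    finally show ?thesis by (simp add: r_def distrib_left mult_ac)
  qed
  ultimately show ?thesis unfolding A'_def V_def by blast
qed

text \<open>All coefficients share the factor \<open>\<alpha> 1\<close>. What remains is the empty
  product for i = 1 and an infinitesimal for i \<ge> 2, so all terms but the first go into
  D.\<close>

lemma lincomb_mat_factor_first:
  fixes U :: "nat \<Rightarrow> 'a :: real_normed_field mat"
  assumes "l \<ge> 1" "\<And>i. i \<in> {1..l} \<Longrightarrow> infinitesimal (\<alpha> i)" "\<And>i. i \<in> {1..l} \<Longrightarrow> U i \<in> carrier_mat n n"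
  shows "\<exists>D. infinitesimal_mat n D \<and>
    lincomb_mat n l (\<lambda>i. \<Prod>j=1..i. \<alpha> j) (\<lambda>i. star_mat (U i)) = \<alpha> 1 \<cdot>\<^sub>m (star_mat (U 1) + D)"
proof (intro exI conjI)
  define D where "D = mat n n (\<lambda>pq. \<Sum>i=2..l. (\<Prod>j=2..i. \<alpha> j) * star_mat (U i) $$ pq)"
  have inf: "infinitesimal (\<Prod>j=2..i. \<alpha> j)" if "i \<in> {2..l}" for i
  proof -
    \<comment> \<open>The factor \<open>\<alpha> 2\<close> alone makes the product infinitesimal;
      the others, possibly none, need only be finite.\<close>
    have "hfinite (\<Prod>j=3..i. \<alpha> j)"
      by (rule hfinite_prod, rule infinitesimal_imp_hfinite, rule assms(2)) (use that in auto)
    moreover have "(\<Prod>j=2..i. \<alpha> j) = \<alpha> 2 * (\<Prod>j=3..i. \<alpha> j)"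
      using that by (simp add: prod.atLeast_Suc_atMost numeral_eq_Suc)
    ultimately show ?thesis using that assms(2)[of 2] by (auto intro: infinitesimal_mult_hfinite)
  qed
  show "infinitesimal_mat n D"
    unfolding infinitesimal_mat_def
  proof (intro conjI allI impI)
    fix p q assume pq: "p < n" "q < n"
    have "hfinite (star_mat (U i) $$ (p, q))" if "i \<in> {2..l}" for i
      using hfinite_mat_star_mat[OF assms(3)[of i]] that pq by (auto simp: hfinite_mat_def)
    then show "infinitesimal (D $$ (p, q))"
      unfolding D_def using pq inf by (auto intro!: infinitesimal_sum infinitesimal_mult_hfinite)
  qed (simp add: D_def)
  show "lincomb_mat n l (\<lambda>i. \<Prod>j=1..i. \<alpha> j) (\<lambda>i. star_mat (U i)) = \<alpha> 1 \<cdot>\<^sub>m (star_mat (U 1) + D)"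
  proof (rule eq_matI)
    fix p q assume "p < dim_row (\<alpha> 1 \<cdot>\<^sub>m (star_mat (U 1) + D))" "q < dim_col (\<alpha> 1 \<cdot>\<^sub>m (star_mat (U 1) + D))"
    then have pq: "p < n" "q < n" by (simp_all add: D_def)
    let ?u = "\<lambda>i. star_mat (U i) $$ (p, q)"
    have "(\<Sum>i=1..l. (\<Prod>j=1..i. \<alpha> j) * ?u i) = \<alpha> 1 * ?u 1 + (\<Sum>i=2..l. (\<Prod>j=1..i. \<alpha> j) * ?u i)"
      using assms(1) by (simp add: sum.atLeast_Suc_atMost numeral_2_eq_2)
    also have "(\<Sum>i=2..l. (\<Prod>j=1..i. \<alpha> j) * ?u i) = (\<Sum>i=2..l. \<alpha> 1 * ((\<Prod>j=2..i. \<alpha> j) * ?u i))"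
      by (intro sum.cong refl) (simp add: prod.atLeast_Suc_atMost numeral_2_eq_2 mult.assoc)
    finally show "lincomb_mat n l (\<lambda>i. \<Prod>j=1..i. \<alpha> j) (\<lambda>i. star_mat (U i)) $$ (p, q) =
        (\<alpha> 1 \<cdot>\<^sub>m (star_mat (U 1) + D)) $$ (p, q)"
      using pq by (simp add: lincomb_mat_def D_def distrib_left sum_distrib_left)
  qed (simp_all add: lincomb_mat_def D_def)
qed

text \<open>The first order formula for each \<open>Qsum k\<close> is applied coefficientwise; R
  collects the signed remainders.\<close>

lemma char_poly_first_order:
  fixes A U :: "'a :: real_normed_field mat"
  assumes A: "A \<in> carrier_mat n n" and U: "U \<in> carrier_mat n n" and D: "infinitesimal_mat n D"
    and \<alpha>: "infinitesimal \<alpha>"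
  shows "\<exists>R. infinitesimal_poly R \<and>
    char_poly (star_mat A + \<alpha> \<cdot>\<^sub>m (star_mat U + D)) - star_poly (char_poly A) -
      Polynomial.smult \<alpha> (\<Sum>k=1..n. monom ((-1) ^ k * (1 / fact (k - 1)) *
        Theta_star n k (replicate (k - 1) (star_mat A) @ [star_mat U])) (n - k)) =
    Polynomial.smult \<alpha> R"
proof -
  let ?At = "star_mat A + \<alpha> \<cdot>\<^sub>m (star_mat U + D)"
  let ?t = "\<lambda>k. 1 / fact (k - 1) * Theta_star n k (replicate (k - 1) (star_mat A) @ [star_mat U])"
  have At: "?At \<in> carrier_mat n n" and A': "star_mat A \<in> carrier_mat n n"
    using A D by (auto simp: infinitesimal_mat_def)
  have "\<forall>k\<in>{1..n}. \<exists>r. infinitesimal r \<and> Qsum k ?At - Qsum k (star_mat A) = \<alpha> * (?t k + r)"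
    using Qsum_first_order[OF A U D \<alpha>] by simp
  then obtain r where r: "\<And>k. k \<in> {1..n} \<Longrightarrow> infinitesimal (r k)"
    "\<And>k. k \<in> {1..n} \<Longrightarrow> Qsum k ?At - Qsum k (star_mat A) = \<alpha> * (?t k + r k)"
    by metis
  define R where "R = (\<Sum>k=1..n. monom ((-1) ^ k * r k) (n - k))"
  have "infinitesimal_poly R"
    unfolding R_def by (intro infinitesimal_poly_sum_monom hfinite_mult_infinitesimal) (use r in auto)
  moreover have "char_poly ?At - star_poly (char_poly A) =
      Polynomial.smult \<alpha> (\<Sum>k=1..n. monom ((-1) ^ k * ?t k) (n - k)) + Polynomial.smult \<alpha> R"
    unfolding star_poly_char_poly[OF A] char_poly_diff[OF At A'] R_def smult_sum2
      sum.distrib[symmetric] smult_monom add_monom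
    by (intro sum.cong refl arg_cong2[where f = monom]) (simp only: r(2), simp add: algebra_simps)
  ultimately show ?thesis by (intro exI[of _ R]) (simp add: mult.assoc)
qed

theorem theorem20:
  fixes A :: "'a :: real_normed_field mat"
    and E At :: "'a star mat"
    and n :: nat
  assumes "n \<ge> 1"
    and "A \<in> carrier_mat n n"
    and "infinitesimal_mat n E"
    and "At = star_mat A + E"
    and "mat_perturbation n At A"
  shows "poly_perturbation (char_poly At) (char_poly A)
    \<and> char_poly At = monom 1 n + (\<Sum>j=1..n. monom ((-1) ^ j * Qsum j (star_mat A + E)) (n - j))
    \<and> (\<forall>k \<in> {1..n}. Qsum k (star_mat A + E) = star_of (Qsum k A) +
          (\<Sum>i=1..k. 1 / (fact i * fact (k - i)) *
             Theta_star n k (replicate (k - i) (star_mat A) @ replicate i E)))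
    \<and> (\<forall>(l :: nat) (\<alpha> :: nat \<Rightarrow> 'a star) (U :: nat \<Rightarrow> 'a mat).
          l \<ge> 1 \<longrightarrow>
          (\<forall>i \<in> {1..l}. infinitesimal (\<alpha> i)) \<longrightarrow>
          (\<forall>i \<in> {1..l}. U i \<in> carrier_mat n n) \<longrightarrow>
          lin_indep_mats n l U \<longrightarrow>
          E = lincomb_mat n l (\<lambda>i. \<Prod>j=1..i. \<alpha> j) (\<lambda>i. star_mat (U i)) \<longrightarrow>
          (let \<Xi>\<^sub>1 = Polynomial.smult (\<alpha> 1) (\<Sum>k=1..n.
                 monom ((-1) ^ k * (1 / fact (k - 1)) *
                   Theta_star n k (replicate (k - 1) (star_mat A) @ [star_mat (U 1)])) (n - k))
           in \<exists>R. infinitesimal_poly R \<and>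
                char_poly At - star_poly (char_poly A) - \<Xi>\<^sub>1 = Polynomial.smult (\<alpha> 1) R))"
proof (intro conjI ballI allI impI)
  note A = assms(2) and E = assms(3) and At = assms(4)
  have E': "E \<in> carrier_mat n n" and A': "star_mat A \<in> carrier_mat n n"
    using A E by (auto simp: infinitesimal_mat_def)
  show "poly_perturbation (char_poly At) (char_poly A)"
    unfolding At by (rule poly_perturbation_char_poly[OF A E])
  show "char_poly At = monom 1 n + (\<Sum>j=1..n. monom ((-1) ^ j * Qsum j (star_mat A + E)) (n - j))"
    unfolding At using E' by (intro char_poly_eq_sum_Qsum) simp
  show "Qsum k (star_mat A + E) = star_of (Qsum k A) + (\<Sum>i=1..k. 1 / (fact i * fact (k - i)) *
      Theta_star n k (replicate (k - i) (star_mat A) @ replicate i E))" for k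
    \<comment> \<open>The standard value is read as a sum of minors over the nonstandard field,
      where the expansion takes place.\<close>
    unfolding Qsum_star_mat[OF A, symmetric] by (rule Qsum_add[OF polarizes_Qsum_Theta_star A' E'])
  fix l :: nat and \<alpha> :: "nat \<Rightarrow> 'a star" and U :: "nat \<Rightarrow> 'a mat"
  assume l: "l \<ge> 1" and \<alpha>: "\<forall>i \<in> {1..l}. infinitesimal (\<alpha> i)"
    and U: "\<forall>i \<in> {1..l}. U i \<in> carrier_mat n n"
    and dec: "E = lincomb_mat n l (\<lambda>i. \<Prod>j=1..i. \<alpha> j) (\<lambda>i. star_mat (U i))"
  \<comment> \<open>The decomposition enters only through the form \<open>\<alpha> 1\<close> times
    an infinitesimal perturbation of \<open>U 1\<close>.\<close>
  obtain D where D: "infinitesimal_mat n D" and ED: "E = \<alpha> 1 \<cdot>\<^sub>m (star_mat (U 1) + D)"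
    unfolding dec using lincomb_mat_factor_first[OF l, of \<alpha> U n] \<alpha> U by blast
  have "U 1 \<in> carrier_mat n n" "infinitesimal (\<alpha> 1)" using \<alpha> U l by auto
  from char_poly_first_order[OF A this(1) D this(2)]
  show "let \<Xi>\<^sub>1 = Polynomial.smult (\<alpha> 1) (\<Sum>k=1..n.
         monom ((-1) ^ k * (1 / fact (k - 1)) *
           Theta_star n k (replicate (k - 1) (star_mat A) @ [star_mat (U 1)])) (n - k))
       in \<exists>R. infinitesimal_poly R \<and>
            char_poly At - star_poly (char_poly A) - \<Xi>\<^sub>1 = Polynomial.smult (\<alpha> 1) R"
    unfolding Let_def At ED .
qed

end
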